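(* Let $G$ be a planar graph with maximum degree $\Delta\geq 27$, and let $H$ be a subgraph of $G$ that is a set of distance-3 cliques. Then any total-$(\Delta+1)$-coloring of $H$ can be extended to a total-$(\Delta+1)$-coloring of $G$.
   Context: All graphs are simple. A total-$k$-coloring of a graph is an assignment of colors from $\{1,\dots,k\}$ to its vertices and edges such that adjacent vertices receive different colors, edges sharing an endpoint receive different colors, and no edge receives the same color as either of its endpoints. A subgraph $H$ of $G$ is a set of distance-3 cliques if $H$ is a disjoint union of vertex-disjoint cliques (possibly of different sizes, including single vertices) and any two vertices in distinct components of $H$ are at distance at least $3$ in $G$. Extending a total coloring $\varphi$ of $H$ to $G$ means finding a total-$k$-coloring of $G$ agreeing with $\varphi$ on all vertices and edges of $H$. *)

theory Defs
  imports "HOL-Analysis.Analysis"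
begin

definition simple_graph :: "'a set \<Rightarrow> 'a set set \<Rightarrow> bool" where
  "simple_graph V E \<longleftrightarrow> finite V \<and>
     (\<forall>e\<in>E. \<exists>u v. u \<noteq> v \<and> e = {u, v} \<and> u \<in> V \<and> v \<in> V)"

definition degree :: "'a set set \<Rightarrow> 'a \<Rightarrow> nat" where
  "degree E v = card {e\<in>E. v \<in> e}"

text \<open>Maximum degree (0 for the empty graph).\<close>
definition max_degree :: "'a set \<Rightarrow> 'a set set \<Rightarrow> nat" where
  "max_degree V E = Sup (degree E ` V)"

definition planar :: "'a set \<Rightarrow> 'a set set \<Rightarrow> bool" where
  "planar V E \<longleftrightarrow> (\<exists>(pos :: 'a \<Rightarrow> complex) (\<gamma> :: 'a set \<Rightarrow> real \<Rightarrow> complex).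
      inj_on pos V \<and>
      (\<forall>e\<in>E. arc (\<gamma> e) \<and> {pathstart (\<gamma> e), pathfinish (\<gamma> e)} = pos ` e) \<and>
      (\<forall>e\<in>E. \<forall>v\<in>V. pos v \<in> path_image (\<gamma> e) \<longrightarrow> v \<in> e) \<and>
      (\<forall>e1\<in>E. \<forall>e2\<in>E. e1 \<noteq> e2 \<longrightarrow>
          path_image (\<gamma> e1) \<inter> path_image (\<gamma> e2) \<subseteq> pos ` (e1 \<inter> e2)))"

definition planar_graph :: "'a set \<Rightarrow> 'a set set \<Rightarrow> bool" where
  "planar_graph V E \<longleftrightarrow> simple_graph V E \<and> planar V E"

definition total_coloring :: "'a set \<Rightarrow> 'a set set \<Rightarrow> nat \<Rightarrow> ('a \<Rightarrow> nat) \<Rightarrow> ('a set \<Rightarrow> nat) \<Rightarrow> bool" where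
  "total_coloring V E k vc ec \<longleftrightarrow>
     (\<forall>v\<in>V. vc v \<in> {1..k}) \<and> (\<forall>e\<in>E. ec e \<in> {1..k}) \<and>
     (\<forall>u v. {u, v} \<in> E \<longrightarrow> vc u \<noteq> vc v) \<and>
     (\<forall>e1\<in>E. \<forall>e2\<in>E. e1 \<noteq> e2 \<and> e1 \<inter> e2 \<noteq> {} \<longrightarrow> ec e1 \<noteq> ec e2) \<and>
     (\<forall>e\<in>E. \<forall>v\<in>e. ec e \<noteq> vc v)"

definition subgraph :: "'a set \<Rightarrow> 'a set set \<Rightarrow> 'a set \<Rightarrow> 'a set set \<Rightarrow> bool" where
  "subgraph VH EH V E \<longleftrightarrow> VH \<subseteq> V \<and> EH \<subseteq> E \<and> (\<forall>e\<in>EH. e \<subseteq> VH)"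

definition walk :: "'a set \<Rightarrow> 'a set set \<Rightarrow> 'a list \<Rightarrow> bool" where
  "walk V E p \<longleftrightarrow> p \<noteq> [] \<and> set p \<subseteq> V \<and> (\<forall>i. Suc i < length p \<longrightarrow> {p ! i, p ! Suc i} \<in> E)"

text \<open>dist_G(u,v) \<ge> k: every u-v walk has at least k edges (infinite distance allowed).\<close>
definition dist_at_least :: "'a set \<Rightarrow> 'a set set \<Rightarrow> nat \<Rightarrow> 'a \<Rightarrow> 'a \<Rightarrow> bool" where
  "dist_at_least V E k u v \<longleftrightarrow>
     (\<forall>p. walk V E p \<and> hd p = u \<and> last p = v \<longrightarrow> length p - 1 \<ge> k)"

text \<open>H=(VH,EH) is a set of distance-3 cliques in G=(V,E): a subgraph whose components
  are cliques (adjacency in H together with equality is transitive on VH), and any two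
  vertices in distinct components are at distance at least 3 in G.\<close>
definition distance3_cliques :: "'a set \<Rightarrow> 'a set set \<Rightarrow> 'a set \<Rightarrow> 'a set set \<Rightarrow> bool" where
  "distance3_cliques V E VH EH \<longleftrightarrow> subgraph VH EH V E \<and>
     (\<forall>u\<in>VH. \<forall>v\<in>VH. \<forall>w\<in>VH. {u, v} \<in> EH \<longrightarrow> {v, w} \<in> EH \<longrightarrow> u \<noteq> w \<longrightarrow> {u, w} \<in> EH) \<and>
     (\<forall>u\<in>VH. \<forall>v\<in>VH. u \<noteq> v \<and> {u, v} \<notin> EH \<longrightarrow> dist_at_least V E 3 u v)"

end

theory Submission
  imports Defs
begin

text \<open>
  Delete edges outside \<open>H\<close> as long as the precolouring does not extend. In the remaining graph an edge
  outside \<open>H\<close> at a vertex of low degree has its other end of high degree, and the bipartite graph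
  between uncoloured \<open>2\<close>-vertices and heavy vertices is a forest, because even cycles are
  \<open>2\<close>-choosable. The bounds \<open>3n - 3\<close> for the edges between heavy vertices and \<open>2n - 2\<close> for the edges of
  the bipartite graph between light and heavy vertices then contradict the degrees of the heavy
  vertices; each vertex of \<open>H\<close> disturbs this count only a little, since cliques of a planar graph have
  at most four vertices and no vertex outside \<open>H\<close> sees two of them.

  The edge bounds come from the Jordan curve theorem without faces: a path inside a cycle splits its
  inside into the insides of two cycles with fewer edges inside, and an inversion moves the whole graph
  into one closed Jordan domain.
\<close>

section \<open>Paths and cycles in graphs\<close>

text \<open>Putting back a single edge only yields conditions such as \<open>k < d u + d v\<close>.
  These tolerate any number of \<open>2\<close>-vertices between heavy vertices of degree
  \<open>k - 1\<close>, which is why a whole even cycle has to be put back at once. A vertex of low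
  degree outside \<open>VH\<close> never obstructs an extension: its colour is erased and chosen
  last. Colours in \<open>VH\<close> cannot be erased, so edges leaving \<open>VH\<close> obey a
  condition weaker by one, and light vertices of \<open>VH\<close> with two heavy neighbours get no
  weight in the count. The count has a budget of 18 per heavy vertex: 10 for the edges between heavy
  vertices, 6 for the light vertices with at least three heavy neighbours, and 2 for the
  \<open>2\<close>-vertices outside \<open>VH\<close>. Each heavy vertex receives at least 18, so
  the bounds may be weak in their additive constants as long as one inequality is strict. The exact
  Euler bound \<open>3n - 6\<close> serves to exclude cliques on five vertices.\<close>

fun path_edges :: "'a list \<Rightarrow> 'a set set" where
  "path_edges (x # y # zs) = insert {x, y} (path_edges (y # zs))"
| "path_edges _ = {}"

definition cycle_edges :: "'a list \<Rightarrow> 'a set set" where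
  "cycle_edges xs = path_edges (xs @ [hd xs])"

definition is_cycle :: "'a set set \<Rightarrow> 'a list \<Rightarrow> bool" where
  "is_cycle E xs \<longleftrightarrow> distinct xs \<and> 3 \<le> length xs \<and> cycle_edges xs \<subseteq> E"

definition neighbours :: "'a set set \<Rightarrow> 'a \<Rightarrow> 'a set" where
  "neighbours E v = {u. {u, v} \<in> E}"

lemma path_edges_append: "path_edges (xs @ z # ys) = path_edges (xs @ [z]) \<union> path_edges (z # ys)"
proof (induction xs)
  case (Cons x xs) then show ?case by (cases xs) auto
qed simp

lemma path_edges_Cons: "xs \<noteq> [] \<Longrightarrow> path_edges (x # xs) = insert {x, hd xs} (path_edges xs)"
  by (cases xs) auto

lemma path_edges_snoc: "xs \<noteq> [] \<Longrightarrow> path_edges (xs @ [y]) = insert {last xs, y} (path_edges xs)"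
  by (induction xs rule: path_edges.induct) auto

lemma path_edges_rev: "path_edges (rev xs) = path_edges xs"
proof (induction xs rule: path_edges.induct)
  case (1 x y zs)
  have "path_edges (rev (x # y # zs)) = path_edges (rev zs @ y # [x])" by simp
  also have "\<dots> = path_edges (rev zs @ [y]) \<union> {{x, y}}"
    by (subst path_edges_append) (auto simp: insert_commute)
  finally show ?case using 1 by simp
qed auto

lemma path_edges_subset: "e \<in> path_edges xs \<Longrightarrow> e \<subseteq> set xs"
  by (induction xs rule: path_edges.induct) auto

lemma Union_path_edges: "2 \<le> length xs \<Longrightarrow> \<Union> (path_edges xs) = set xs"
proof (induction xs rule: path_edges.induct)
  case (1 x y zs) then show ?case by (cases zs) auto
qed auto

lemma finite_path_edges [simp]: "finite (path_edges xs)"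
  by (induction xs rule: path_edges.induct) auto

lemma card_path_edges: "distinct xs \<Longrightarrow> card (path_edges xs) = length xs - 1"
proof (induction xs rule: path_edges.induct)
  case (1 x y zs)
  then have "{x, y} \<notin> path_edges (y # zs)" using path_edges_subset[of "{x,y}" "y # zs"] by auto
  with 1 show ?case by simp
qed auto

lemma cycle_edges_split:
  "cycle_edges (x # xs @ y # ys) = path_edges (x # xs @ [y]) \<union> path_edges (y # ys @ [x])"
  using path_edges_append[of "x # xs" y "ys @ [x]"] by (simp add: cycle_edges_def)

lemma cycle_edges_append_commute: "cycle_edges (xs @ ys) = cycle_edges (ys @ xs)"
proof (cases xs)
  case xs: (Cons x xs')
  show ?thesis
  proof (cases ys)
    case (Cons y ys')
    then show ?thesis using xs cycle_edges_split[of x xs' y ys'] cycle_edges_split[of y ys' x xs']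
      by auto
  qed simp
qed simp

lemma is_cycle_append_commute: "is_cycle E (xs @ ys) \<Longrightarrow> is_cycle E (ys @ xs)"
  by (auto simp: is_cycle_def cycle_edges_append_commute)

lemma cycle_edges_Cons:
  assumes "xs \<noteq> []" shows "cycle_edges (x # xs) = insert {last xs, x} (path_edges (x # xs))"
proof -
  obtain ys z where xs: "xs = ys @ [z]" using assms by (cases xs rule: rev_cases) auto
  show ?thesis using path_edges_append[of "x # ys" z "[x]"] by (simp add: xs cycle_edges_def)
qed

lemma Union_cycle_edges: "2 \<le> length xs \<Longrightarrow> \<Union> (cycle_edges xs) = set xs"
  using Union_path_edges[of "xs @ [hd xs]"] by (cases xs) (auto simp: cycle_edges_def)

lemma finite_cycle_edges [simp]: "finite (cycle_edges xs)"
  by (simp add: cycle_edges_def)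

lemma card_cycle_edges:
  assumes "distinct xs" "3 \<le> length xs"
  shows "card (cycle_edges xs) = length xs"
proof -
  obtain x y z zs where xs: "xs = x # y # z # zs"
    using assms(2) by (auto simp: numeral_3_eq_3 Suc_le_length_iff)
  have "{last (y # z # zs), x} \<notin> path_edges (y # z # zs)"
    using path_edges_subset[of "{last (y # z # zs), x}" "y # z # zs"] assms(1) xs by auto
  moreover have "last (y # z # zs) \<noteq> y" using assms(1) xs last_in_set[of "z # zs"] by auto
  ultimately have "{last (y # z # zs), x} \<notin> path_edges xs"
    using assms(1) xs by (auto simp: doubleton_eq_iff)
  then show ?thesis
    using card_path_edges[OF assms(1)] cycle_edges_Cons[of "y # z # zs" x] xs by simp
qed

text \<open>A cycle is a list with an arbitrary start. Rotation brings two chosen vertices into the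
  shape in which the cycle falls into two arcs between them.\<close>

lemma rotate_cycle_to:
  assumes "is_cycle E zs" "x \<in> set zs" "y \<in> set zs" "x \<noteq> y"
  obtains xs ys where "is_cycle E (x # xs @ y # ys)" "cycle_edges (x # xs @ y # ys) = cycle_edges zs"
    "set (x # xs @ y # ys) = set zs" "length (x # xs @ y # ys) = length zs"
proof -
  obtain as bs where zs: "zs = as @ x # bs" using assms(2) by (meson split_list)
  have "y \<in> set (bs @ as)" using assms zs by auto
  then obtain xs ys where "bs @ as = xs @ y # ys" by (meson split_list)
  then have eq: "x # xs @ y # ys = (x # bs) @ as" by simp
  show ?thesis
  proof (rule that[of xs ys])
    show "is_cycle E (x # xs @ y # ys)"
      using is_cycle_append_commute[of E as "x # bs"] assms(1) zs eq by simp
    show "cycle_edges (x # xs @ y # ys) = cycle_edges zs"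
      unfolding eq zs by (rule cycle_edges_append_commute)
    show "set (x # xs @ y # ys) = set zs" unfolding eq zs by auto
    show "length (x # xs @ y # ys) = length zs" unfolding eq zs by auto
  qed
qed

lemma is_cycle_mono: "is_cycle E xs \<Longrightarrow> E \<subseteq> E' \<Longrightarrow> is_cycle E' xs"
  by (auto simp: is_cycle_def)

text \<open>The walk is kept a path while it grows: if the new first vertex already occurs,
  everything before that occurrence is dropped.\<close>

lemma rtrancl_imp_path:
  assumes "(u, v) \<in> {(a, b). {a, b} \<in> E \<and> a \<in> S \<and> b \<in> S}\<^sup>*" "v \<in> S"
  shows "\<exists>ps. ps \<noteq> [] \<and> hd ps = u \<and> last ps = v \<and> distinct ps \<and> set ps \<subseteq> S \<and> path_edges ps \<subseteq> E"
  using assms(1)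
proof (induction rule: converse_rtrancl_induct)
  case base
  show ?case by (rule exI[of _ "[v]"]) (use assms in auto)
next
  case (step a b)
  then obtain ps where ps: "ps \<noteq> []" "hd ps = b" "last ps = v" "distinct ps" "set ps \<subseteq> S" "path_edges ps \<subseteq> E"
    by blast
  show ?case
  proof (cases "a \<in> set ps")
    case True
    then obtain p1 p2 where p: "ps = p1 @ a # p2" by (meson split_list)
    show ?thesis
      by (rule exI[of _ "a # p2"]) (use ps p path_edges_append[of p1 a p2] in auto)
  next
    case False
    show ?thesis
      by (rule exI[of _ "a # ps"]) (use ps step False in \<open>auto simp: path_edges_Cons\<close>)
  qed
qed

lemma simple_graph_subset: "simple_graph V E \<Longrightarrow> E' \<subseteq> E \<Longrightarrow> simple_graph V E'"
  by (auto simp: simple_graph_def)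

lemma simple_graph_edgeE:
  assumes "simple_graph V E" "e \<in> E"
  obtains u v where "u \<noteq> v" "e = {u, v}" "u \<in> V" "v \<in> V"
  using assms unfolding simple_graph_def by blast

lemma simple_graph_edge_eq:
  assumes "simple_graph V E" "e \<in> E" "u \<in> e" "v \<in> e" "u \<noteq> v"
  shows "e = {u, v}"
proof -
  obtain a b where "e = {a, b}" using assms(1,2) by (rule simple_graph_edgeE)
  then show ?thesis using assms by auto
qed

lemma simple_graph_finite_edges: "simple_graph V E \<Longrightarrow> finite E"
  by (rule finite_subset[of _ "Pow V"]) (auto simp: simple_graph_def)

lemma simple_graph_no_loop: "simple_graph V E \<Longrightarrow> {u, v} \<in> E \<Longrightarrow> u \<noteq> v \<and> u \<in> V \<and> v \<in> V"
  unfolding simple_graph_def by (metis doubleton_eq_iff)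

lemma neighbours_subset: "simple_graph V E \<Longrightarrow> neighbours E v \<subseteq> V"
  using simple_graph_no_loop unfolding neighbours_def by fastforce

lemma finite_neighbours: "simple_graph V E \<Longrightarrow> finite (neighbours E v)"
  using neighbours_subset finite_subset unfolding simple_graph_def by metis

lemma card_neighbours:
  assumes "simple_graph V E"
  shows "card (neighbours E v) = degree E v"
proof -
  have "bij_betw (\<lambda>u. {u, v}) (neighbours E v) {e \<in> E. v \<in> e}"
    unfolding bij_betw_def
  proof
    show "inj_on (\<lambda>u. {u, v}) (neighbours E v)" by (auto simp: inj_on_def doubleton_eq_iff)
    show "(\<lambda>u. {u, v}) ` neighbours E v = {e \<in> E. v \<in> e}"
    proof (intro equalityI subsetI)
      fix e assume "e \<in> {e \<in> E. v \<in> e}"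
      then obtain a b where "e = {a, b}" "e \<in> E" "v \<in> e"
        using simple_graph_edgeE[OF assms] by (metis mem_Collect_eq)
      then show "e \<in> (\<lambda>u. {u, v}) ` neighbours E v"
        unfolding neighbours_def by (auto simp: insert_commute image_iff)
    qed (auto simp: neighbours_def)
  qed
  then show ?thesis unfolding degree_def by (rule bij_betw_same_card)
qed

text \<open>The end of a longest path has a second neighbour, necessarily on the path.\<close>
lemma cycle_if_min_degree_2:
  assumes s: "simple_graph V E" and "V \<noteq> {}" and deg: "\<And>v. v \<in> V \<Longrightarrow> 2 \<le> degree E v"
  shows "\<exists>xs. is_cycle E xs"
proof -
  define P where "P = (\<lambda>xs. xs \<noteq> [] \<and> distinct xs \<and> set xs \<subseteq> V \<and> path_edges xs \<subseteq> E)"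
  have fin: "finite V" using s by (simp add: simple_graph_def)
  obtain v where "v \<in> V" using assms(2) by blast
  then have "P [v]" by (auto simp: P_def)
  moreover have "\<forall>xs. P xs \<longrightarrow> length xs \<le> card V"
    unfolding P_def using fin by (metis card_mono distinct_card)
  then have "\<forall>xs. P xs \<longrightarrow> length xs < Suc (card V)" by (simp add: less_Suc_eq_le)
  ultimately obtain xs where P: "P xs" and max: "\<And>ys. P ys \<Longrightarrow> length ys \<le> length xs"
    using ex_has_greatest_nat[of P "[v]" length "Suc (card V)"] by blast
  obtain x zs where xs: "xs = x # zs" using P by (cases xs) (auto simp: P_def)
  have xV: "x \<in> V" using P xs by (auto simp: P_def)
  have nb: "neighbours E x \<subseteq> set zs"
  proof
    fix u assume "u \<in> neighbours E x"
    then have e: "{u, x} \<in> E" by (simp add: neighbours_def)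
    then have ux: "u \<noteq> x" "u \<in> V" using simple_graph_no_loop[OF s] by blast+
    show "u \<in> set zs"
    proof (rule ccontr)
      assume "u \<notin> set zs"
      then have "P (u # xs)" using P e ux xs by (auto simp: P_def)
      then show False using max[of "u # xs"] by simp
    qed
  qed
  have "card (neighbours E x) \<ge> 2" using deg[OF xV] card_neighbours[OF s] by simp
  moreover have "card (neighbours E x) \<le> 1" if "neighbours E x \<subseteq> {hd zs}"
    using card_mono[OF _ that] by simp
  ultimately obtain u where u: "u \<in> neighbours E x" "u \<noteq> hd zs" by fastforce
  obtain as bs where zs: "zs = as @ u # bs" using nb u(1) by (meson subsetD split_list)
  have "as \<noteq> []" using u(2) zs by auto
  have "path_edges (x # as @ [u]) \<subseteq> E"
    using P xs zs path_edges_append[of "x # as" u bs] by (auto simp: P_def)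
  then have "is_cycle E (x # as @ [u])"
    using P xs zs u(1) \<open>as \<noteq> []\<close> cycle_edges_Cons[of "as @ [u]" x]
    by (cases as) (auto simp: is_cycle_def P_def neighbours_def)
  then show ?thesis by blast
qed

text \<open>Some vertex has degree at most 1, since otherwise there is a cycle, and it takes at most
  one edge with it.\<close>

lemma forest_card_edges:
  assumes "simple_graph V E" "V \<noteq> {}" "\<And>xs. \<not> is_cycle E xs"
  shows "card E < card V"
  using assms
proof (induction "card V" arbitrary: V E rule: less_induct)
  case less
  have finV: "finite V" and finE: "finite E"
    using less.prems(1) simple_graph_finite_edges by (auto simp: simple_graph_def)
  obtain v where v: "v \<in> V" "degree E v \<le> 1"
    using cycle_if_min_degree_2[OF less.prems(1,2)] less.prems(3) by (metis not_less_eq_eq one_add_one plus_1_eq_Suc)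
  define E' where "E' = {e \<in> E. v \<notin> e}"
  have "E = E' \<union> {e \<in> E. v \<in> e}" by (auto simp: E'_def)
  then have cE: "card E \<le> card E' + 1"
    using v(2) card_Un_le[of E' "{e \<in> E. v \<in> e}"] unfolding degree_def by simp
  show ?case
  proof (cases "V = {v}")
    case True
    then have "E = {}" using less.prems(1) by (auto simp: simple_graph_def)
    then show ?thesis using True by simp
  next
    case False
    have s: "simple_graph (V - {v}) E'"
      using less.prems(1) unfolding simple_graph_def E'_def by fastforce
    have "card E' < card (V - {v})"
    proof (rule less.hyps[OF _ s])
      show "card (V - {v}) < card V" using v(1) finV by (rule card_Diff1_less[rotated])
      show "V - {v} \<noteq> {}" using False v by blast
      show "\<not> is_cycle E' xs" for xs using less.prems(3)[of xs] is_cycle_mono[of E' xs E] by (auto simp: E'_def)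
    qed
    then show ?thesis using cE v finV by simp
  qed
qed

section \<open>Plane drawings\<close>

text \<open>The drawing is a parameter and not hidden behind an existential, so that the same lemmas
  can be instantiated again for the inverted drawing of the same graph.\<close>

locale plane_drawing =
  fixes V :: "'a set" and E :: "'a set set" and pos :: "'a \<Rightarrow> complex" and \<gamma> :: "'a set \<Rightarrow> real \<Rightarrow> complex"
  assumes simple: "simple_graph V E"
    and inj_pos: "inj_on pos V"
    and edge_arc: "e \<in> E \<Longrightarrow> arc (\<gamma> e)"
    and edge_ends: "e \<in> E \<Longrightarrow> {pathstart (\<gamma> e), pathfinish (\<gamma> e)} = pos ` e"
    and vertex_on_edge: "e \<in> E \<Longrightarrow> v \<in> V \<Longrightarrow> pos v \<in> path_image (\<gamma> e) \<Longrightarrow> v \<in> e"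
    and edges_meet: "e1 \<in> E \<Longrightarrow> e2 \<in> E \<Longrightarrow> e1 \<noteq> e2 \<Longrightarrow>
          path_image (\<gamma> e1) \<inter> path_image (\<gamma> e2) \<subseteq> pos ` (e1 \<inter> e2)"
begin

definition trace :: "'a set set \<Rightarrow> complex set" where
  "trace F = (\<Union>e\<in>F. path_image (\<gamma> e))"

text \<open>One interior point decides on which side of a cycle an edge lies: away from its ends an
  edge meets no other edge and no vertex.\<close>

definition mid :: "'a set \<Rightarrow> complex" where
  "mid e = \<gamma> e (1/2)"

definition region :: "'a list \<Rightarrow> complex set" where
  "region C = inside (trace (cycle_edges C))"

lemma edge_subset: "e \<in> E \<Longrightarrow> e \<subseteq> V"
  using simple by (auto simp: simple_graph_def)

lemma Union_subset: "F \<subseteq> E \<Longrightarrow> \<Union>F \<subseteq> V"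
  using edge_subset by blast

lemma trace_Un: "trace (F \<union> G) = trace F \<union> trace G"
  by (auto simp: trace_def)

lemma pos_in_trace_iff:
  assumes "F \<subseteq> E" "v \<in> V" shows "pos v \<in> trace F \<longleftrightarrow> v \<in> \<Union>F"
proof
  assume "pos v \<in> trace F"
  then obtain e where "e \<in> F" "pos v \<in> path_image (\<gamma> e)" by (auto simp: trace_def)
  then show "v \<in> \<Union>F" using vertex_on_edge assms by blast
next
  assume "v \<in> \<Union>F"
  then obtain e where e: "e \<in> F" "v \<in> e" by blast
  then have "pos v \<in> {pathstart (\<gamma> e), pathfinish (\<gamma> e)}" using edge_ends[of e] assms by auto
  then have "pos v \<in> path_image (\<gamma> e)" by auto
  then show "pos v \<in> trace F" using e by (auto simp: trace_def)
qed

lemma trace_Int: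
  assumes "F \<subseteq> E" "G \<subseteq> E" "F \<inter> G = {}"
  shows "trace F \<inter> trace G \<subseteq> pos ` (\<Union>F \<inter> \<Union>G)"
proof
  fix z assume "z \<in> trace F \<inter> trace G"
  then obtain e e' where e: "e \<in> F" "e' \<in> G" "z \<in> path_image (\<gamma> e) \<inter> path_image (\<gamma> e')"
    by (auto simp: trace_def)
  moreover have "e \<noteq> e'" using e assms by blast
  ultimately have "z \<in> pos ` (e \<inter> e')" using edges_meet assms by blast
  then show "z \<in> pos ` (\<Union>F \<inter> \<Union>G)" using e by blast
qed

lemma edge_point_vertex:
  assumes "e \<in> E" "t \<in> {0..1}" "v \<in> V" "\<gamma> e t = pos v"
  shows "v \<in> e \<and> (t = 0 \<or> t = 1)"
proof -
  have v: "v \<in> e"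
    using vertex_on_edge[OF assms(1,3)] assms(2,4) by (metis imageI path_image_def)
  then have "pos v \<in> {\<gamma> e 0, \<gamma> e 1}"
    using edge_ends[OF assms(1)] by (auto simp: pathstart_def pathfinish_def)
  moreover have "inj_on (\<gamma> e) {0..1}" using edge_arc[OF assms(1)] by (simp add: arc_def)
  ultimately show ?thesis using v assms inj_onD[of "\<gamma> e" "{0..1}" t 0] inj_onD[of "\<gamma> e" "{0..1}" t 1]
    by auto
qed

lemma mid_not_pos: "e \<in> E \<Longrightarrow> v \<in> V \<Longrightarrow> mid e \<noteq> pos v"
  using edge_point_vertex[of e "1/2" v] by (auto simp: mid_def)

lemma mid_in_path_image: "mid e \<in> path_image (\<gamma> e)"
  by (auto simp: mid_def path_image_def)

lemma mid_in_trace_iff: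
  assumes "F \<subseteq> E" "e \<in> E" shows "mid e \<in> trace F \<longleftrightarrow> e \<in> F"
proof
  assume "mid e \<in> trace F"
  then obtain e' where e': "e' \<in> F" "mid e \<in> path_image (\<gamma> e')" by (auto simp: trace_def)
  show "e \<in> F"
  proof (rule ccontr)
    assume "e \<notin> F"
    then have "mid e \<in> pos ` (e \<inter> e')" using edges_meet[of e e'] e' assms mid_in_path_image by blast
    then show False using mid_not_pos assms edge_subset by blast
  qed
qed (use mid_in_path_image in \<open>auto simp: trace_def\<close>)

text \<open>The edge without its other end is connected and misses \<open>trace F\<close>. The other
  end is left out because it may lie on \<open>F\<close>; this is why \<open>T\<close> is
  half-open.\<close>

lemma mid_inside_iff_end_inside:
  assumes "F \<subseteq> E" "e \<in> E" "e \<notin> F" "v \<in> e" "v \<notin> \<Union>F"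
  shows "mid e \<in> inside (trace F) \<longleftrightarrow> pos v \<in> inside (trace F)"
proof -
  have vV: "v \<in> V" using assms edge_subset by blast
  have inj: "inj_on (\<gamma> e) {0..1}" and path: "continuous_on {0..1} (\<gamma> e)"
    using edge_arc[OF assms(2)] by (auto simp: arc_def path_def)
  have "pos v \<in> {\<gamma> e 0, \<gamma> e 1}"
    using edge_ends[OF assms(2)] assms(4) by (auto simp: pathstart_def pathfinish_def)
  then obtain s where s: "s = 0 \<or> s = 1" "pos v = \<gamma> e s" by auto
  define T where "T = {0<..<1} \<union> {s}"
  have T: "T = {0..<1} \<or> T = {0<..1}" using s(1) by (auto simp: T_def)
  have T01: "T \<subseteq> {0..1}" using s by (auto simp: T_def)
  have "connected T" using T by auto
  then have con: "connected (\<gamma> e ` T)"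
    using connected_continuous_image continuous_on_subset[OF path T01] by blast
  have "\<gamma> e t \<notin> trace F" if t: "t \<in> T" for t
  proof
    assume "\<gamma> e t \<in> trace F"
    then obtain e' where e': "e' \<in> F" "\<gamma> e t \<in> path_image (\<gamma> e')" by (auto simp: trace_def)
    have "\<gamma> e t \<in> path_image (\<gamma> e)" using T01 t by (auto simp: path_image_def)
    then have "\<gamma> e t \<in> pos ` (e \<inter> e')" using edges_meet[of e e'] e' assms by blast
    then obtain w where w: "w \<in> e" "w \<in> e'" "\<gamma> e t = pos w" by blast
    then have wV: "w \<in> V" using edge_subset assms by blast
    have "t = 0 \<or> t = 1" using edge_point_vertex[OF assms(2) _ wV w(3)] T01 t by blast
    then have "t = s" using t s(1) by (auto simp: T_def)
    then have "w = v" using w s inj_pos wV vV by (metis inj_onD)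
    then show False using w e' assms by blast
  qed
  then have "\<gamma> e ` T \<subseteq> - trace F" by blast
  moreover have "mid e \<in> \<gamma> e ` T" "pos v \<in> \<gamma> e ` T" by (auto simp: mid_def T_def s)
  ultimately have "connected_component (- trace F) (mid e) (pos v)"
    using con unfolding connected_component_def by blast
  then show ?thesis using inside_same_component connected_component_sym by metis
qed

lemma path_arc:
  assumes "path_edges xs \<subseteq> E" "distinct xs" "2 \<le> length xs"
  shows "\<exists>p. arc p \<and> pathstart p = pos (hd xs) \<and> pathfinish p = pos (last xs) \<and>
             path_image p = trace (path_edges xs)"
  using assms
proof (induction xs rule: path_edges.induct)
  case (1 x y zs)
  have xy: "{x, y} \<in> E" "x \<noteq> y" using 1 by auto
  have "\<exists>p. arc p \<and> pathstart p = pos x \<and> pathfinish p = pos y \<and> path_image p = path_image (\<gamma> {x, y})"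
  proof (cases "pathstart (\<gamma> {x, y}) = pos x")
    case True
    have "pos y \<noteq> pos x" using inj_pos xy edge_subset[OF xy(1)] by (auto dest: inj_onD)
    then have "pathfinish (\<gamma> {x, y}) = pos y" using edge_ends[OF xy(1)] True by auto
    then show ?thesis using True edge_arc[OF xy(1)] by blast
  next
    case False
    then have "pathfinish (\<gamma> {x, y}) = pos x" "pathstart (\<gamma> {x, y}) = pos y"
      using edge_ends[OF xy(1)] by (auto simp: doubleton_eq_iff)
    then show ?thesis using edge_arc[OF xy(1)] arc_reversepath[of "\<gamma> {x, y}"]
      by (intro exI[of _ "reversepath (\<gamma> {x, y})"]) auto
  qed
  then obtain p where p: "arc p" "pathstart p = pos x" "pathfinish p = pos y"
    "path_image p = path_image (\<gamma> {x, y})" by blast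
  show ?case
  proof (cases zs)
    case Nil
    then show ?thesis using p by (auto simp: trace_def)
  next
    case (Cons z zs')
    then have "\<exists>q. arc q \<and> pathstart q = pos (hd (y # zs)) \<and> pathfinish q = pos (last (y # zs)) \<and>
             path_image q = trace (path_edges (y # zs))" using 1 by auto
    then obtain q where q: "arc q" "pathstart q = pos y" "pathfinish q = pos (last (y # zs))"
      "path_image q = trace (path_edges (y # zs))" by auto
    have "x \<notin> \<Union>(path_edges (y # zs))" using path_edges_subset[of _ "y # zs"] 1 by auto
    moreover have "{x, y} \<notin> path_edges (y # zs)" using calculation by blast
    ultimately have "trace {{x, y}} \<inter> trace (path_edges (y # zs)) \<subseteq> {pos y}"
      using trace_Int[of "{{x, y}}" "path_edges (y # zs)"] 1 by auto
    then have "arc (p +++ q)" using p q by (intro arc_join) (auto simp: trace_def)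
    then show ?thesis using p q by (intro exI[of _ "p +++ q"]) (auto simp: path_image_join trace_def)
  qed
qed auto

lemma cycle_parts:
  assumes "is_cycle E (x # xs @ y # ys)"
  defines "A \<equiv> path_edges (x # xs @ [y])" and "B \<equiv> path_edges (y # ys @ [x])"
  shows "A \<subseteq> E" "B \<subseteq> E" "A \<inter> B = {}" "trace A \<inter> trace B = {pos x, pos y}"
    "cycle_edges (x # xs @ y # ys) = A \<union> B" "x \<in> V" "y \<in> V"
proof -
  let ?C = "x # xs @ y # ys"
  have d: "distinct ?C" "3 \<le> length ?C" and sub: "cycle_edges ?C \<subseteq> E"
    using assms(1) by (auto simp: is_cycle_def)
  show eq: "cycle_edges ?C = A \<union> B" unfolding A_def B_def by (rule cycle_edges_split)
  show AE: "A \<subseteq> E" and BE: "B \<subseteq> E" using eq sub by auto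
  \<comment> \<open>Disjointness by counting: the lengths of the two arcs add up to the number of
    edges of the cycle, so no edge is shared.\<close>
  have "card (A \<union> B) = length ?C" using card_cycle_edges[OF d] eq by simp
  moreover have "card A = length xs + 1" unfolding A_def using d by (subst card_path_edges) auto
  moreover have "card B = length ys + 1" unfolding B_def using d by (subst card_path_edges) auto
  moreover have "finite A" "finite B" by (auto simp: A_def B_def)
  ultimately have "card (A \<inter> B) = 0" using card_Un_Int[of A B] by simp
  then show AB: "A \<inter> B = {}" using \<open>finite A\<close> by simp
  have UA: "\<Union>A = set (x # xs @ [y])" unfolding A_def by (rule Union_path_edges) simp
  have UB: "\<Union>B = set (y # ys @ [x])" unfolding B_def by (rule Union_path_edges) simp
  show V: "x \<in> V" "y \<in> V" using UA Union_subset[OF AE] by auto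
  have "\<Union>A \<inter> \<Union>B = {x, y}" using UA UB d by auto
  then have "trace A \<inter> trace B \<subseteq> {pos x, pos y}" using trace_Int[OF AE BE AB] by auto
  moreover have "{pos x, pos y} \<subseteq> trace A \<inter> trace B"
    using pos_in_trace_iff[OF AE] pos_in_trace_iff[OF BE] UA UB V by auto
  ultimately show "trace A \<inter> trace B = {pos x, pos y}" by blast
qed

lemma cycle_curve:
  assumes "is_cycle E C"
  shows "\<exists>p. simple_path p \<and> pathfinish p = pathstart p \<and> path_image p = trace (cycle_edges C)"
proof -
  obtain x y ys where C: "C = x # y # ys"
    using assms by (auto simp: is_cycle_def numeral_3_eq_3 Suc_le_length_iff)
  then have cyc: "is_cycle E (x # [] @ y # ys)" using assms by simp
  note parts = cycle_parts[OF cyc]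
  have d: "distinct (x # y # ys)" using assms C by (auto simp: is_cycle_def)
  obtain p where p: "arc p" "pathstart p = pos x" "pathfinish p = pos y"
      "path_image p = trace (path_edges (x # [] @ [y]))"
    using path_arc[OF parts(1)] d by auto
  obtain q where q: "arc q" "pathstart q = pos y" "pathfinish q = pos x"
      "path_image q = trace (path_edges (y # ys @ [x]))"
    using path_arc[OF parts(2)] d by auto
  have "simple_path (p +++ q)"
    by (rule simple_path_join_loop) (use p q parts(4) in auto)
  moreover have "path_image (p +++ q) = trace (cycle_edges C)"
    using p q parts(5) C by (simp add: path_image_join trace_def)
  ultimately show ?thesis using p q by (intro exI[of _ "p +++ q"]) auto
qed

section \<open>Insides of cycles and their division by chord paths\<close>

definition inner_vertices :: "'a list \<Rightarrow> 'a set" where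
  "inner_vertices C = {v \<in> V. pos v \<in> region C}"

definition inner_edges :: "'a list \<Rightarrow> 'a set set" where
  "inner_edges C = {e \<in> E. mid e \<in> region C}"

lemma finite_inner [simp]: "finite (inner_vertices C)" "finite (inner_edges C)"
  using simple simple_graph_finite_edges[OF simple]
  by (auto simp: inner_vertices_def inner_edges_def simple_graph_def)

lemma inner_edge_not_cycle_edge:
  assumes "is_cycle E C" "e \<in> inner_edges C" shows "e \<notin> cycle_edges C"
proof
  assume "e \<in> cycle_edges C"
  then have "mid e \<in> trace (cycle_edges C)"
    using mid_in_trace_iff[of "cycle_edges C" e] assms by (auto simp: is_cycle_def)
  moreover have "mid e \<in> inside (trace (cycle_edges C))"
    using assms(2) by (simp add: inner_edges_def region_def)
  ultimately show False using inside_no_overlap by blast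
qed

text \<open>The theorem on theta curves, in terms of the graph: three arcs join \<open>x\<close> and
  \<open>y\<close>, and the one that meets the inside of the other two divides it. The vertices of
  \<open>ps\<close> and the \<open>length ps + 1\<close> edges of the chord path lie inside
  \<open>C\<close> but on the boundary of both parts, which accounts for the additional
  terms.\<close>

lemma chord_split:
  assumes cyc: "is_cycle E (x # xs @ y # ys)"
    and ps: "distinct ps" "set ps \<inter> set (x # xs @ y # ys) = {}"
    and P: "path_edges (x # ps @ [y]) \<subseteq> E"
    and disj: "path_edges (x # ps @ [y]) \<inter> cycle_edges (x # xs @ y # ys) = {}"
    and ins: "trace (path_edges (x # ps @ [y])) \<inter> region (x # xs @ y # ys) \<noteq> {}"
  defines "C \<equiv> x # xs @ y # ys" and "C1 \<equiv> x # xs @ y # rev ps" and "C2 \<equiv> x # ps @ y # ys"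
  shows "is_cycle E C1" "is_cycle E C2"
    "card (inner_edges C) = card (inner_edges C1) + card (inner_edges C2) + length ps + 1"
    "card (inner_vertices C) = card (inner_vertices C1) + card (inner_vertices C2) + length ps"
proof -
  define A where "A = path_edges (x # xs @ [y])"
  define B where "B = path_edges (y # ys @ [x])"
  define D where "D = path_edges (x # ps @ [y])"
  note parts = cycle_parts[OF cyc, folded A_def B_def]
  have dC: "distinct (x # xs @ y # ys)" using cyc by (simp add: is_cycle_def)
  have D': "D = path_edges (y # rev ps @ [x])"
    unfolding D_def using path_edges_rev[of "x # ps @ [y]"] by simp
  have c1: "cycle_edges C1 = A \<union> D"
    unfolding C1_def A_def D' by (rule cycle_edges_split)
  have c2: "cycle_edges C2 = B \<union> D"
    unfolding C2_def B_def D_def cycle_edges_split by blast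
  have DE: "D \<subseteq> E" using P by (simp add: D_def)
  have DAB: "D \<inter> A = {}" "D \<inter> B = {}" using disj parts(5) by (auto simp: D_def)
  \<comment> \<open>Excludes degenerate cycles with two vertices: there \<open>{x, y}\<close> would
    belong both to the chord path and to an arc of the cycle.\<close>
  have "{x, y} \<in> A" if "xs = []" using that by (simp add: A_def)
  moreover have "{x, y} \<in> B" if "ys = []" using that by (auto simp: B_def)
  moreover have "{x, y} \<in> D" if "ps = []" using that by (simp add: D_def)
  ultimately have ne: "xs \<noteq> [] \<or> ps \<noteq> []" "ys \<noteq> [] \<or> ps \<noteq> []" using DAB by blast+
  have len: "3 \<le> length C1" "3 \<le> length C2"
    using ne by (cases xs; cases ys; cases ps; simp add: C1_def C2_def)+
  show cyc1: "is_cycle E C1" using dC ps len c1 parts(1) DE by (auto simp: is_cycle_def C1_def)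
  show cyc2: "is_cycle E C2" using dC ps len c2 parts(2) DE by (auto simp: is_cycle_def C2_def)
  have AD: "trace A \<inter> trace D = {pos x, pos y}"
    using cycle_parts(4)[OF cyc1[unfolded C1_def]] by (simp add: A_def D')
  have BD: "trace B \<inter> trace D = {pos x, pos y}"
    using cycle_parts(4)[OF cyc2[unfolded C2_def]] by (auto simp: B_def D_def)
  have B': "B = path_edges (x # rev ys @ [y])"
    unfolding B_def using path_edges_rev[of "x # rev ys @ [y]"] by simp
  obtain a where a: "arc a" "pathstart a = pos x" "pathfinish a = pos y" "path_image a = trace A"
    using path_arc[of "x # xs @ [y]"] parts(1) dC by (auto simp: A_def)
  obtain b where b: "arc b" "pathstart b = pos x" "pathfinish b = pos y" "path_image b = trace B"
    using path_arc[of "x # rev ys @ [y]"] parts(2) dC by (auto simp: B')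
  obtain c where c: "arc c" "pathstart c = pos x" "pathfinish c = pos y" "path_image c = trace D"
    using path_arc[of "x # ps @ [y]"] DE ps dC by (auto simp: D_def)
  have "pos x \<noteq> pos y" using inj_pos parts(6,7) dC by (auto dest: inj_onD)
  moreover have "trace D \<inter> inside (trace A \<union> trace B) \<noteq> {}"
    using ins by (simp add: region_def parts(5) trace_Un flip: D_def)
  ultimately have
    "inside (trace A \<union> trace D) \<inter> inside (trace B \<union> trace D) = {} \<and>
     inside (trace A \<union> trace D) \<union> inside (trace B \<union> trace D) \<union> (trace D - {pos x, pos y})
       = inside (trace A \<union> trace B)"
    using split_inside_simple_closed_curve[of a "pos x" "pos y" b c] a b c AD BD parts(4)
      arc_imp_simple_path by metis
  then have split: "region C1 \<inter> region C2 = {}"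
      "region C1 \<union> region C2 \<union> (trace D - {pos x, pos y}) = region C"
    by (simp_all add: region_def C_def c1 c2 parts(5) trace_Un)
  have D1: "region C1 \<inter> trace D = {}" "region C2 \<inter> trace D = {}"
    using inside_no_overlap unfolding region_def c1 c2 trace_Un by blast+
  have mD: "mid e \<in> trace D - {pos x, pos y} \<longleftrightarrow> e \<in> D" if "e \<in> E" for e
    using mid_in_trace_iff[OF DE that] mid_not_pos[OF that] parts(6,7) by auto
  have "mid e \<in> region C \<longleftrightarrow> mid e \<in> region C1 \<or> mid e \<in> region C2 \<or> e \<in> D" if "e \<in> E" for e
    using mD[OF that] split(2) by auto
  then have "inner_edges C = inner_edges C1 \<union> inner_edges C2 \<union> D"
    unfolding inner_edges_def using DE by blast
  moreover have "inner_edges C1 \<inter> inner_edges C2 = {}" using split(1) by (auto simp: inner_edges_def)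
  moreover have "(inner_edges C1 \<union> inner_edges C2) \<inter> D = {}"
    using D1 mD by (auto simp: inner_edges_def)
  moreover have "card D = length ps + 1" unfolding D_def using ps dC by (subst card_path_edges) auto
  moreover have "finite D" by (simp add: D_def)
  ultimately show "card (inner_edges C) = card (inner_edges C1) + card (inner_edges C2) + length ps + 1"
    by (simp add: card_Un_disjoint)
  have UD: "\<Union>D = set (x # ps @ [y])" unfolding D_def by (rule Union_path_edges) simp
  have psV: "set ps \<subseteq> V" using UD Union_subset[OF DE] by auto
  have vD: "pos v \<in> trace D - {pos x, pos y} \<longleftrightarrow> v \<in> set ps" if "v \<in> V" for v
    using pos_in_trace_iff[OF DE that] UD inj_on_eq_iff[OF inj_pos that] parts(6,7) ps by auto
  have "pos v \<in> region C \<longleftrightarrow> pos v \<in> region C1 \<or> pos v \<in> region C2 \<or> v \<in> set ps" if "v \<in> V" for v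
    using vD[OF that] split(2) by auto
  then have "inner_vertices C = inner_vertices C1 \<union> inner_vertices C2 \<union> set ps"
    unfolding inner_vertices_def using psV by blast
  moreover have "inner_vertices C1 \<inter> inner_vertices C2 = {}" using split(1) by (auto simp: inner_vertices_def)
  moreover have "(inner_vertices C1 \<union> inner_vertices C2) \<inter> set ps = {}"
    using D1 vD by (auto simp: inner_vertices_def)
  ultimately show "card (inner_vertices C) = card (inner_vertices C1) + card (inner_vertices C2) + length ps"
    using ps(1) by (simp add: card_Un_disjoint distinct_card)
qed


text \<open>The hypothesis \<open>two\<close> is 2-connectedness stated for edges: no division of
  the edges into two nonempty classes has fewer than two common vertices. If \<open>e0\<close> has
  both ends on \<open>C\<close>, it is a chord itself. Otherwise let \<open>R\<close> be the
  component, off \<open>C\<close>, of an end of \<open>e0\<close>. The edges touching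
  \<open>R\<close> share at least two vertices with the remaining edges; these vertices lie on
  \<open>C\<close>, and a path through \<open>R\<close> joins them.\<close>

lemma chord_exists:
  assumes two: "\<And>F. F \<subseteq> E \<Longrightarrow> F \<noteq> {} \<Longrightarrow> F \<noteq> E \<Longrightarrow> 2 \<le> card (\<Union>F \<inter> \<Union>(E - F))"
    and cyc: "is_cycle E C" and e0: "e0 \<in> inner_edges C"
  obtains x y ps where "x \<in> set C" "y \<in> set C" "x \<noteq> y" "distinct ps" "set ps \<inter> set C = {}"
    "path_edges (x # ps @ [y]) \<subseteq> E" "path_edges (x # ps @ [y]) \<inter> cycle_edges C = {}"
    "trace (path_edges (x # ps @ [y])) \<inter> region C \<noteq> {}"
proof -
  have CE: "cycle_edges C \<subseteq> E" and UC: "\<Union>(cycle_edges C) = set C"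
    using cyc Union_cycle_edges[of C] unfolding is_cycle_def by linarith+
  have e0E: "e0 \<in> E" and e0in: "mid e0 \<in> region C" using e0 by (auto simp: inner_edges_def)
  have e0C: "e0 \<notin> cycle_edges C" by (rule inner_edge_not_cycle_edge[OF cyc e0])
  show ?thesis
  proof (cases "e0 \<subseteq> set C")
    case True
    obtain x y where xy: "e0 = {x, y}" "x \<noteq> y" using simple_graph_edgeE[OF simple e0E] by metis
    show ?thesis
      by (rule that[of x y "[]"])
        (use True xy e0E e0C e0in mid_in_path_image[of e0] in \<open>auto simp: trace_def\<close>)
  next
    case False
    then obtain u where u: "u \<in> e0" "u \<notin> set C" by blast
    define r where "r = {(a, b). {a, b} \<in> E \<and> a \<in> - set C \<and> b \<in> - set C}"
    define R where "R = {v. (v, u) \<in> r\<^sup>*}"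
    have RC: "R \<inter> set C = {}"
    proof -
      have "v \<notin> set C" if "(v, u) \<in> r\<^sup>*" for v
        using that by (cases rule: converse_rtranclE) (use u in \<open>auto simp: r_def\<close>)
      then show ?thesis by (auto simp: R_def)
    qed
    have uR: "u \<in> R" by (simp add: R_def)
    have step: "w \<in> R" if "v \<in> R" "{w, v} \<in> E" "w \<notin> set C" for v w
    proof -
      have "(w, v) \<in> r" using that RC by (auto simp: r_def)
      then show ?thesis using that(1) by (auto simp: R_def intro: converse_rtrancl_into_rtrancl)
    qed
    define F where "F = {e \<in> E. e \<inter> R \<noteq> {}}"
    have "e0 \<in> F" using u uR e0E by (auto simp: F_def)
    moreover have "F \<noteq> E"
    proof
      assume "F = E"
      moreover obtain e where e: "e \<in> cycle_edges C"
        using UC cyc by (cases C) (auto simp: is_cycle_def)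
      ultimately have "e \<in> F" using CE by blast
      then show False using e UC RC by (auto simp: F_def)
    qed
    ultimately have "2 \<le> card (\<Union>F \<inter> \<Union>(E - F))" using two[of F] by (auto simp: F_def)
    moreover have subC: "\<Union>F \<inter> \<Union>(E - F) \<subseteq> set C"
    proof
      fix w assume "w \<in> \<Union>F \<inter> \<Union>(E - F)"
      then obtain e e' v where e: "e \<in> E" "w \<in> e" "v \<in> e" "v \<in> R" "e' \<in> E" "w \<in> e'" "e' \<inter> R = {}"
        by (auto simp: F_def)
      then have "w \<noteq> v" by blast
      then have "e = {w, v}" using simple_graph_edge_eq[OF simple e(1-3)] by blast
      then show "w \<in> set C" using step[of v w] e by blast
    qed
    ultimately obtain T where "T \<subseteq> \<Union>F \<inter> \<Union>(E - F)" "card T = 2" by (meson obtain_subset_with_card_n)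
    then obtain x y where xy: "x \<noteq> y" "x \<in> \<Union>F \<inter> \<Union>(E - F)" "y \<in> \<Union>F \<inter> \<Union>(E - F)"
      by (auto simp: card_2_iff)
    have nb: "\<exists>v\<in>R. {w, v} \<in> E" if w: "w \<in> \<Union>F \<inter> \<Union>(E - F)" for w
    proof -
      obtain e where "e \<in> F" "w \<in> e" using w by blast
      then obtain v where e: "e \<in> E" "w \<in> e" "v \<in> e" "v \<in> R" by (auto simp: F_def)
      have "w \<noteq> v" using w subC RC e by blast
      then have "e = {w, v}" using simple_graph_edge_eq[OF simple e(1-3)] by blast
      then show ?thesis using e by blast
    qed
    obtain p q where p: "p \<in> R" "{x, p} \<in> E" and q: "q \<in> R" "{y, q} \<in> E" using nb xy by blast
    have "sym r" by (auto simp: r_def sym_def insert_commute)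
    then have "(u, q) \<in> r\<^sup>*" using q(1) by (auto simp: R_def dest: symD[OF sym_rtrancl])
    then have "(p, q) \<in> r\<^sup>*" using p(1) by (auto simp: R_def)
    moreover have "q \<in> - set C" using q RC by blast
    ultimately obtain ps where ps: "ps \<noteq> []" "hd ps = p" "last ps = q" "distinct ps"
        "set ps \<subseteq> - set C" "path_edges ps \<subseteq> E"
      using rtrancl_imp_path[of p q E "- set C"] unfolding r_def by blast
    have eq: "path_edges (x # ps @ [y]) = insert {x, p} (insert {q, y} (path_edges ps))"
      using ps by (simp add: path_edges_Cons path_edges_snoc)
    have nC: "e \<notin> cycle_edges C" if e: "e \<in> path_edges (x # ps @ [y])" for e
    proof -
      have "e = {x, p} \<or> e = {q, y} \<or> e \<noteq> {} \<and> e \<subseteq> set ps"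
      proof (cases "e \<in> path_edges ps")
        case True
        then obtain a b where "e = {a, b}" using simple_graph_edgeE[OF simple] ps(6) by blast
        then show ?thesis using True path_edges_subset[of e ps] by auto
      qed (use e eq in auto)
      then have "\<exists>w\<in>e. w \<notin> set C" using p q RC ps(5) by blast
      then show ?thesis using UC by blast
    qed
    \<comment> \<open>An edge between two vertices off the cycle cannot cross it, so all of
      \<open>R\<close> lies on the same side as \<open>u\<close>.\<close>
    have region_R: "pos v \<in> region C" if "(v, u) \<in> r\<^sup>*" for v
      using that
    proof (induction rule: converse_rtrancl_induct)
      case base
      show ?case using mid_inside_iff_end_inside[OF CE e0E e0C u(1)] u(2) UC e0in by (auto simp: region_def)
    next
      case (step v w)
      then have vw: "{v, w} \<in> E" "v \<notin> \<Union>(cycle_edges C)" "w \<notin> \<Union>(cycle_edges C)" using UC by (auto simp: r_def)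
      then have "{v, w} \<notin> cycle_edges C" by blast
      then show ?case
        using mid_inside_iff_end_inside[OF CE vw(1) _ _ vw(2)] mid_inside_iff_end_inside[OF CE vw(1) _ _ vw(3)] step.IH
        by (auto simp: region_def)
    qed
    then have "pos p \<in> region C" using p by (auto simp: R_def)
    moreover have pE: "path_edges (x # ps @ [y]) \<subseteq> E" using eq p q ps by (auto simp: insert_commute)
    moreover have "pos p \<in> trace (path_edges (x # ps @ [y]))"
      using pos_in_trace_iff[OF pE, of p] p eq edge_subset[OF p(2)] by auto
    ultimately show ?thesis
      using that[of x y ps] xy subC ps nC by blast
  qed
qed

text \<open>Splitting a cycle along a chord path keeps this inequality tight, and it is trivial for a cycle
  with no edge inside.\<close>
lemma inner_edges_le:
  assumes two: "\<And>F. F \<subseteq> E \<Longrightarrow> F \<noteq> {} \<Longrightarrow> F \<noteq> E \<Longrightarrow> 2 \<le> card (\<Union>F \<inter> \<Union>(E - F))"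
    and girth: "\<And>C. is_cycle E C \<Longrightarrow> g \<le> length C" and g: "3 \<le> g"
    and "is_cycle E C"
  shows "(int g - 2) * card (inner_edges C) \<le> int g * card (inner_vertices C) + length C - g"
  using assms(4)
proof (induction "card (inner_edges C)" arbitrary: C rule: less_induct)
  case less
  show ?case
  proof (cases "inner_edges C = {}")
    case True
    have "int g \<le> int (length C)" "0 \<le> int g * int (card (inner_vertices C))"
      using girth[OF less.prems] by simp_all
    then have "0 \<le> int g * int (card (inner_vertices C)) + length C - g" by linarith
    then show ?thesis using True by simp
  next
    case False
    then obtain e0 where "e0 \<in> inner_edges C" by blast
    from chord_exists[OF two less.prems this] obtain x y ps where
      P: "x \<in> set C" "y \<in> set C" "x \<noteq> y" "distinct ps" "set ps \<inter> set C = {}"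
        "path_edges (x # ps @ [y]) \<subseteq> E" "path_edges (x # ps @ [y]) \<inter> cycle_edges C = {}"
        "trace (path_edges (x # ps @ [y])) \<inter> region C \<noteq> {}" by blast
    obtain xs ys where D: "is_cycle E (x # xs @ y # ys)" "cycle_edges (x # xs @ y # ys) = cycle_edges C"
        "set (x # xs @ y # ys) = set C" "length (x # xs @ y # ys) = length C"
      using rotate_cycle_to[OF less.prems P(1-3)] by metis
    have reg: "region (x # xs @ y # ys) = region C" by (simp only: region_def D(2))
    define C1 where "C1 = x # xs @ y # rev ps"
    define C2 where "C2 = x # ps @ y # ys"
    note S = chord_split[OF D(1) P(4), unfolded reg D(2,3), OF P(5-8), folded C1_def C2_def]
    have eq: "inner_edges (x # xs @ y # ys) = inner_edges C" "inner_vertices (x # xs @ y # ys) = inner_vertices C"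
      by (simp_all only: inner_edges_def inner_vertices_def reg)
    have "(int g - 2) * card (inner_edges C1) \<le> int g * card (inner_vertices C1) + length C1 - g"
      by (rule less.hyps[OF _ S(1)]) (use S(3) eq in simp)
    moreover have "(int g - 2) * card (inner_edges C2) \<le> int g * card (inner_vertices C2) + length C2 - g"
      by (rule less.hyps[OF _ S(2)]) (use S(3) eq in simp)
    \<comment> \<open>With \<open>p = length ps\<close> the constants agree exactly:
      \<open>(g - 2) (p + 1) + (2 p + 2) - 2 g = g p - g\<close>.\<close>
    moreover have "length C1 + length C2 = length C + 2 * length ps + 2"
      using D(4) by (simp add: C1_def C2_def)
    then have "int (length C1) + int (length C2) = int (length C) + 2 * int (length ps) + 2" by linarith
    moreover have "(int g - 2) * card (inner_edges C) =
        (int g - 2) * card (inner_edges C1) + (int g - 2) * card (inner_edges C2) + (int g - 2) * (length ps + 1)"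
      using S(3) eq by (simp add: algebra_simps)
    moreover have "int g * card (inner_vertices C) =
        int g * card (inner_vertices C1) + int g * card (inner_vertices C2) + int g * length ps"
      using S(4) eq by (simp add: algebra_simps)
    ultimately show ?thesis by (simp add: algebra_simps)
  qed
qed

text \<open>Passing to one part of a chord split loses at least one inner edge, so the descent ends
  at a cycle that bounds a face. Its inside later provides the centre of the inversion.\<close>

lemma empty_cycle_exists:
  assumes two: "\<And>F. F \<subseteq> E \<Longrightarrow> F \<noteq> {} \<Longrightarrow> F \<noteq> E \<Longrightarrow> 2 \<le> card (\<Union>F \<inter> \<Union>(E - F))"
    and "is_cycle E C"
  shows "\<exists>C. is_cycle E C \<and> inner_edges C = {}"
  using assms(2)
proof (induction "card (inner_edges C)" arbitrary: C rule: less_induct)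
  case less
  show ?case
  proof (cases "inner_edges C = {}")
    case False
    then obtain e0 where "e0 \<in> inner_edges C" by blast
    from chord_exists[OF two less.prems this] obtain x y ps where
      P: "x \<in> set C" "y \<in> set C" "x \<noteq> y" "distinct ps" "set ps \<inter> set C = {}"
        "path_edges (x # ps @ [y]) \<subseteq> E" "path_edges (x # ps @ [y]) \<inter> cycle_edges C = {}"
        "trace (path_edges (x # ps @ [y])) \<inter> region C \<noteq> {}" by blast
    obtain xs ys where D: "is_cycle E (x # xs @ y # ys)" "cycle_edges (x # xs @ y # ys) = cycle_edges C"
        "set (x # xs @ y # ys) = set C" "length (x # xs @ y # ys) = length C"
      using rotate_cycle_to[OF less.prems P(1-3)] by metis
    have reg: "region (x # xs @ y # ys) = region C" by (simp only: region_def D(2))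
    note S = chord_split[OF D(1) P(4), unfolded reg D(2,3), OF P(5-8)]
    have "inner_edges (x # xs @ y # ys) = inner_edges C" by (simp only: inner_edges_def reg)
    then show ?thesis using less.hyps[OF _ S(1)] S(3) by simp
  qed (use less.prems in blast)
qed

end

section \<open>Inversion at a point inside a cycle\<close>

text \<open>If \<open>\<phi> w\<close> is not inside the image curve, the connected image of the
  outside lies outside it. The punctured inside has a connected image too, unbounded because of the
  pole at \<open>z0\<close>, and so it also lies outside. Then the inside of the image curve
  contains at most 0, the one value not taken away from \<open>z0\<close>; but it is open and
  nonempty.\<close>

lemma inversion_outside_imp_inside:
  fixes c :: "real \<Rightarrow> complex"
  assumes c: "simple_path c" "pathfinish c = pathstart c"
    and z0: "z0 \<in> inside (path_image c)" and w: "w \<in> outside (path_image c)"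
  defines "\<phi> \<equiv> \<lambda>z. inverse (z - z0)"
  shows "\<phi> w \<in> inside (\<phi> ` path_image c)"
proof (rule ccontr)
  assume not_in: "\<phi> w \<notin> inside (\<phi> ` path_image c)"
  let ?J = "path_image c" and ?K = "\<phi> ` path_image c"
  note J = Jordan_inside_outside[OF c]
  have z0J: "z0 \<notin> ?J" using z0 J by blast
  \<comment> \<open>As \<open>inverse 0 = 0\<close>, the map is injective on the whole plane,
    \<open>z0\<close> included; only continuity fails there.\<close>
  have inj: "inj \<phi>" by (auto simp: inj_on_def \<phi>_def)
  have cont: "continuous_on S \<phi>" if "z0 \<notin> S" for S
    unfolding \<phi>_def using that by (intro continuous_intros) auto
  have c': "simple_path (\<phi> \<circ> c)" "pathfinish (\<phi> \<circ> c) = pathstart (\<phi> \<circ> c)"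
  proof -
    have "continuous_on {0..1} (\<phi> \<circ> c)"
      by (rule continuous_on_compose)
        (use c(1) z0J in \<open>auto simp: simple_path_def path_def path_image_def intro!: cont\<close>)
    then show "simple_path (\<phi> \<circ> c)" using c(1) inj
      by (auto simp: simple_path_def path_def loop_free_def inj_eq)
    show "pathfinish (\<phi> \<circ> c) = pathstart (\<phi> \<circ> c)" using c(2) by (simp add: pathfinish_compose pathstart_compose)
  qed
  have K: "path_image (\<phi> \<circ> c) = ?K" by (simp add: path_image_compose)
  note K' = Jordan_inside_outside[OF c', unfolded K]
  have sub_out: "S \<subseteq> outside ?K" if S: "connected S" "S \<inter> ?K = {}" "S \<inter> outside ?K \<noteq> {}" for S
  proof -
    have "S \<subseteq> inside ?K \<union> outside ?K" using S(2) by auto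
    then show ?thesis using connectedD[OF S(1), of "inside ?K" "outside ?K"] S(3) K' by blast
  qed
  have wK: "\<phi> w \<in> outside ?K"
  proof -
    have "w \<notin> ?J" using w outside_no_overlap[of ?J] by blast
    then have "\<phi> w \<notin> ?K" using inj by (auto simp: inj_eq)
    then show ?thesis using not_in inside_Un_outside[of ?K] by blast
  qed
  have "connected (\<phi> ` outside ?J)"
  proof (rule connected_continuous_image[OF cont])
    show "z0 \<notin> outside ?J" using z0 J by blast
    show "connected (outside ?J)" using J by blast
  qed
  moreover have "\<phi> ` outside ?J \<inter> ?K = {}"
    using inj outside_no_overlap[of ?J] by (simp flip: image_Int)
  ultimately have out: "\<phi> ` outside ?J \<subseteq> outside ?K" using sub_out wK w by blast
  have con: "connected (\<phi> ` (inside ?J - {z0}))"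
    by (rule connected_continuous_image[OF cont]) (use J in \<open>auto intro!: connected_open_delete\<close>)
  have dis: "\<phi> ` (inside ?J - {z0}) \<inter> ?K = {}"
  proof -
    have "(inside ?J - {z0}) \<inter> ?J = {}" using inside_no_overlap[of ?J] by blast
    then show ?thesis using inj by (metis image_Int image_empty)
  qed
  have unb: "\<not> bounded (\<phi> ` (inside ?J - {z0}))"
  proof
    assume "bounded (\<phi> ` (inside ?J - {z0}))"
    then obtain B where B: "B > 0" "\<And>z. z \<in> inside ?J - {z0} \<Longrightarrow> norm (\<phi> z) \<le> B"
      by (auto simp: bounded_pos)
    obtain \<epsilon> where \<epsilon>: "\<epsilon> > 0" "ball z0 \<epsilon> \<subseteq> inside ?J" using z0 J openE by blast
    define t where "t = min (\<epsilon> / 2) (1 / (2 * B))"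
    have t: "t > 0" "t < \<epsilon>" "t < 1 / B" using \<epsilon> B by (auto simp: t_def min_def field_simps)
    have "z0 + of_real t \<in> inside ?J - {z0}" using t \<epsilon> by (auto simp: dist_norm)
    then have "norm (\<phi> (z0 + of_real t)) \<le> B" by (rule B(2))
    then have "1 / t \<le> B" using t by (simp add: \<phi>_def norm_inverse divide_inverse)
    then show False using t B by (simp add: field_simps)
  qed
  have "\<phi> ` (inside ?J - {z0}) \<inter> outside ?K \<noteq> {}"
  proof
    assume "\<phi> ` (inside ?J - {z0}) \<inter> outside ?K = {}"
    then have "\<phi> ` (inside ?J - {z0}) \<subseteq> inside ?K" using dis inside_Un_outside[of ?K] by blast
    then show False using unb K' by (meson bounded_subset)
  qed
  then have inn: "\<phi> ` (inside ?J - {z0}) \<subseteq> outside ?K" using sub_out con dis by blast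
  have "inside ?K \<subseteq> {0}"
  proof
    fix z assume z: "z \<in> inside ?K"
    show "z \<in> {0}"
    proof (rule ccontr)
      assume "z \<notin> {0}"
      then have zz: "z = \<phi> (z0 + inverse z)" "z0 + inverse z \<noteq> z0" by (auto simp: \<phi>_def)
      have "z \<notin> ?K" using z inside_no_overlap by blast
      then have "z0 + inverse z \<notin> ?J" using zz(1) by blast
      then have "z \<in> outside ?K" using zz out inn inside_Un_outside[of ?J] by blast
      then show False using z K' by blast
    qed
  qed
  moreover have "open (inside ?K)" "inside ?K \<noteq> {}" using K' by auto
  ultimately show False using not_open_singleton[of "0::complex"] by (metis subset_singletonD)
qed

context plane_drawing begin

lemma open_edge_inside_iff:
  assumes "F \<subseteq> E" "e \<in> E" "e \<notin> F" "t \<in> {0<..<1}"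
  shows "\<gamma> e t \<in> inside (trace F) \<longleftrightarrow> mid e \<in> inside (trace F)"
proof -
  have path: "continuous_on {0..1} (\<gamma> e)"
    using edge_arc[OF assms(2)] by (auto simp: arc_def path_def)
  have con: "connected (\<gamma> e ` {0<..<1})"
    by (rule connected_continuous_image[OF continuous_on_subset[OF path]]) auto
  have "\<gamma> e s \<notin> trace F" if s: "s \<in> {0<..<1}" for s
  proof
    assume "\<gamma> e s \<in> trace F"
    then obtain e' where e': "e' \<in> F" "\<gamma> e s \<in> path_image (\<gamma> e')" by (auto simp: trace_def)
    have "\<gamma> e s \<in> path_image (\<gamma> e)" using s by (auto simp: path_image_def)
    then have "\<gamma> e s \<in> pos ` (e \<inter> e')" using edges_meet[of e e'] e' assms by blast
    then obtain w where "w \<in> V" "\<gamma> e s = pos w" using edge_subset assms by blast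
    then show False using edge_point_vertex[OF assms(2), of s w] s by auto
  qed
  then have "\<gamma> e ` {0<..<1} \<subseteq> - trace F" by blast
  moreover have "mid e \<in> \<gamma> e ` {0<..<1}" by (auto simp: mid_def)
  ultimately have "connected_component (- trace F) (mid e) (\<gamma> e t)"
    using con assms(4) unfolding connected_component_def by blast
  then show ?thesis using inside_same_component connected_component_sym by metis
qed

lemma plane_drawing_inversion:
  assumes "z0 \<notin> pos ` V" "z0 \<notin> trace E"
  defines "\<phi> \<equiv> \<lambda>z. inverse (z - z0)"
  shows "plane_drawing V E (\<phi> \<circ> pos) (\<lambda>e. \<phi> \<circ> \<gamma> e)"
proof
  have inj: "inj \<phi>" by (auto simp: inj_on_def \<phi>_def)
  show "simple_graph V E" by (rule simple)
  show "inj_on (\<phi> \<circ> pos) V" using inj_pos inj by (simp add: comp_inj_on inj_on_subset)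
  show "arc (\<phi> \<circ> \<gamma> e)" if "e \<in> E" for e
  proof -
    have "z0 \<notin> \<gamma> e ` {0..1}" using assms(2) that by (auto simp: trace_def path_image_def)
    then have "continuous_on (\<gamma> e ` {0..1}) \<phi>"
      unfolding \<phi>_def by (intro continuous_intros) auto
    then have "continuous_on {0..1} (\<phi> \<circ> \<gamma> e)"
      using edge_arc[OF that] by (intro continuous_on_compose) (auto simp: arc_def path_def)
    then show ?thesis using edge_arc[OF that] inj
      by (auto simp: arc_def path_def intro: comp_inj_on inj_on_subset)
  qed
  show "{pathstart (\<phi> \<circ> \<gamma> e), pathfinish (\<phi> \<circ> \<gamma> e)} = (\<phi> \<circ> pos) ` e" if "e \<in> E" for e
    using edge_ends[OF that] by (metis image_comp image_empty image_insert pathfinish_compose pathstart_compose)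
  show "v \<in> e" if "e \<in> E" "v \<in> V" "(\<phi> \<circ> pos) v \<in> path_image (\<phi> \<circ> \<gamma> e)" for e v
  proof -
    have "pos v \<in> path_image (\<gamma> e)" using that(3) inj by (auto simp: path_image_compose inj_eq)
    then show ?thesis using vertex_on_edge that by blast
  qed
  show "path_image (\<phi> \<circ> \<gamma> e1) \<inter> path_image (\<phi> \<circ> \<gamma> e2) \<subseteq> (\<phi> \<circ> pos) ` (e1 \<inter> e2)"
    if "e1 \<in> E" "e2 \<in> E" "e1 \<noteq> e2" for e1 e2
    using edges_meet[OF that] unfolding path_image_compose image_Int[OF inj, symmetric] by (metis image_comp image_mono)
qed

text \<open>Euler's bound for girth \<open>g\<close>. After inversion at a point inside an empty
  cycle \<open>C0\<close>, every vertex and edge that is not on \<open>C0\<close> lies inside it, so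
  \<open>inner_edges_le\<close> for the inverted drawing counts the whole graph.\<close>

lemma card_edges_le_two_connected:
  assumes two: "\<And>F. F \<subseteq> E \<Longrightarrow> F \<noteq> {} \<Longrightarrow> F \<noteq> E \<Longrightarrow> 2 \<le> card (\<Union>F \<inter> \<Union>(E - F))"
    and girth: "\<And>C. is_cycle E C \<Longrightarrow> g \<le> length C" and g: "3 \<le> g"
    and "is_cycle E C" and V: "V = \<Union>E"
  shows "(int g - 2) * card E \<le> int g * card V - 2 * g"
proof -
  obtain C0 where C0: "is_cycle E C0" "inner_edges C0 = {}"
    using empty_cycle_exists[OF two assms(4)] by blast
  have CE: "cycle_edges C0 \<subseteq> E" and UC: "\<Union>(cycle_edges C0) = set C0"
    and len: "distinct C0" "3 \<le> length C0"
    using C0(1) Union_cycle_edges[of C0] unfolding is_cycle_def by linarith+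
  obtain p where p: "simple_path p" "pathfinish p = pathstart p" "path_image p = trace (cycle_edges C0)"
    using cycle_curve[OF C0(1)] by blast
  have "region C0 \<noteq> {}" unfolding region_def using Jordan_inside_outside[OF p(1,2)] p(3) by metis
  then obtain z0 where z0: "z0 \<in> region C0" by blast
  have z0C: "z0 \<notin> trace (cycle_edges C0)" using z0 inside_no_overlap unfolding region_def by blast
  have noE: "mid e \<notin> inside (trace (cycle_edges C0))" if "e \<in> E" for e
    using C0(2) that by (auto simp: inner_edges_def region_def)
  \<comment> \<open>An isolated vertex could lie inside a cycle without inner edges. With
    \<open>V = \<Union>E\<close> each vertex has an edge, which would have to lie inside as
    well.\<close>
  have vreg: "pos v \<notin> region C0" if "v \<in> V" for v
  proof
    assume v: "pos v \<in> region C0"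
    then have "pos v \<notin> trace (cycle_edges C0)" using inside_no_overlap unfolding region_def by blast
    then have vC: "v \<notin> \<Union>(cycle_edges C0)" using pos_in_trace_iff[OF CE that] by blast
    obtain e where e: "e \<in> E" "v \<in> e" using \<open>v \<in> V\<close> unfolding V by (rule UnionE)
    then show False using mid_inside_iff_end_inside[OF CE e(1) _ e(2) vC] vC v noE
      by (auto simp: region_def)
  qed
  then have zV: "z0 \<notin> pos ` V" using z0 by blast
  have zE: "z0 \<notin> trace E"
  proof
    assume "z0 \<in> trace E"
    then obtain e t where e: "e \<in> E" "t \<in> {0..1}" "z0 = \<gamma> e t" by (auto simp: trace_def path_image_def)
    then have eC: "e \<notin> cycle_edges C0" using z0C by (auto simp: trace_def path_image_def)
    have "\<gamma> e 0 \<in> pos ` V" "\<gamma> e 1 \<in> pos ` V"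
      using edge_ends[OF e(1)] edge_subset[OF e(1)] by (auto simp: pathstart_def pathfinish_def)
    then have "t \<noteq> 0" "t \<noteq> 1" using e zV by auto
    then have "t \<in> {0<..<1}" using e by auto
    then show False using open_edge_inside_iff[OF CE e(1) eC] noE[OF e(1)] z0 e by (auto simp: region_def)
  qed
  define \<phi> where "\<phi> = (\<lambda>z. inverse (z - z0))"
  interpret I: plane_drawing V E "\<phi> \<circ> pos" "\<lambda>e. \<phi> \<circ> \<gamma> e"
    unfolding \<phi>_def by (rule plane_drawing_inversion[OF zV zE])
  have tr: "I.trace F = \<phi> ` trace F" for F
    by (auto simp: I.trace_def trace_def path_image_compose)
  have inv: "\<phi> w \<in> I.region C0" if "w \<notin> region C0" "w \<notin> trace (cycle_edges C0)" for w
  proof -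
    have "w \<in> outside (trace (cycle_edges C0))" using that inside_Un_outside unfolding region_def by blast
    then have "\<phi> w \<in> inside (\<phi> ` trace (cycle_edges C0))"
      using inversion_outside_imp_inside[OF p(1,2), of z0 w] z0 by (simp add: region_def p(3) \<phi>_def)
    then show ?thesis by (simp add: I.region_def tr)
  qed
  have "I.inner_edges C0 = E - cycle_edges C0"
  proof
    show "I.inner_edges C0 \<subseteq> E - cycle_edges C0"
      using I.inner_edge_not_cycle_edge[OF C0(1)] by (auto simp: I.inner_edges_def)
    show "E - cycle_edges C0 \<subseteq> I.inner_edges C0"
    proof
      fix e assume e: "e \<in> E - cycle_edges C0"
      then have "\<phi> (mid e) \<in> I.region C0"
        using inv[of "mid e"] noE[of e] mid_in_trace_iff[OF CE, of e] by (simp add: region_def)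
      then show "e \<in> I.inner_edges C0" using e by (simp add: I.inner_edges_def I.mid_def mid_def)
    qed
  qed
  then have "card (I.inner_edges C0) = card E - length C0" "length C0 \<le> card E"
    using card_Diff_subset[OF _ CE] card_mono[OF simple_graph_finite_edges[OF simple] CE]
      card_cycle_edges[OF len] by auto
  then have ce: "int (card (I.inner_edges C0)) = int (card E) - int (length C0)" by simp
  have CV: "set C0 \<subseteq> V" using UC V CE by blast
  have "I.inner_vertices C0 = V - set C0"
  proof
    show "I.inner_vertices C0 \<subseteq> V - set C0"
    proof
      fix v assume "v \<in> I.inner_vertices C0"
      then have "v \<in> V" "(\<phi> \<circ> pos) v \<in> inside (I.trace (cycle_edges C0))"
        by (auto simp: I.inner_vertices_def I.region_def)
      then show "v \<in> V - set C0"
        using I.pos_in_trace_iff[OF CE] inside_no_overlap UC by blast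
    qed
    show "V - set C0 \<subseteq> I.inner_vertices C0"
    proof
      fix v assume v: "v \<in> V - set C0"
      then have "\<phi> (pos v) \<in> I.region C0"
        using inv[of "pos v"] vreg[of v] pos_in_trace_iff[OF CE, of v] UC by simp
      then show "v \<in> I.inner_vertices C0" using v by (simp add: I.inner_vertices_def)
    qed
  qed
  moreover have "finite V" using simple by (simp add: simple_graph_def)
  ultimately have "card (I.inner_vertices C0) = card V - length C0" "length C0 \<le> card V"
    using card_Diff_subset[OF _ CV] card_mono[OF _ CV] distinct_card[OF len(1)] by auto
  then have cv: "int (card (I.inner_vertices C0)) = int (card V) - int (length C0)" by simp
  have "(int g - 2) * card (I.inner_edges C0) \<le> int g * card (I.inner_vertices C0) + length C0 - g"
    by (rule I.inner_edges_le[OF two girth g C0(1)])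
  \<comment> \<open>The edges of \<open>C0\<close> are put back:
    \<open>- g c + c + (g - 2) c = - c\<close> with \<open>c = length C0\<close>. The girth
    \<open>c \<ge> g\<close> then gives \<open>- 2 g\<close>.\<close>
  then have "(int g - 2) * card E \<le> int g * card V - length C0 - g"
    unfolding ce cv by (simp add: algebra_simps)
  then show ?thesis using girth[OF C0(1)] by simp
qed

end

section \<open>Edge bounds for planar graphs\<close>

lemma plane_drawing_iff:
  "plane_drawing V E pos \<gamma> \<longleftrightarrow> simple_graph V E \<and> inj_on pos V \<and>
      (\<forall>e\<in>E. arc (\<gamma> e) \<and> {pathstart (\<gamma> e), pathfinish (\<gamma> e)} = pos ` e) \<and>
      (\<forall>e\<in>E. \<forall>v\<in>V. pos v \<in> path_image (\<gamma> e) \<longrightarrow> v \<in> e) \<and>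
      (\<forall>e1\<in>E. \<forall>e2\<in>E. e1 \<noteq> e2 \<longrightarrow>
          path_image (\<gamma> e1) \<inter> path_image (\<gamma> e2) \<subseteq> pos ` (e1 \<inter> e2))" (is "_ \<longleftrightarrow> ?R")
proof
  assume "plane_drawing V E pos \<gamma>"
  then interpret plane_drawing V E pos \<gamma> .
  show ?R
    by (intro conjI ballI impI) (rule simple inj_pos edge_arc edge_ends vertex_on_edge edges_meet; assumption)+
next
  assume ?R then show "plane_drawing V E pos \<gamma>" by (intro plane_drawing.intro) simp_all
qed

lemma planar_graph_iff: "planar_graph V E \<longleftrightarrow> (\<exists>pos \<gamma>. plane_drawing V E pos \<gamma>)"
  unfolding planar_graph_def planar_def plane_drawing_iff by (simp only: ex_simps)

lemma planar_graph_subset: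
  assumes "planar_graph V E" "V' \<subseteq> V" "E' \<subseteq> E" "\<And>e. e \<in> E' \<Longrightarrow> e \<subseteq> V'"
  shows "planar_graph V' E'"
proof -
  obtain pos \<gamma> where "plane_drawing V E pos \<gamma>" using assms(1) unfolding planar_graph_iff by (elim exE)
  then interpret plane_drawing V E pos \<gamma> .
  have "simple_graph V' E'"
    unfolding simple_graph_def
  proof (intro conjI ballI)
    show "finite V'" using simple assms(2) by (auto simp: simple_graph_def intro: finite_subset)
    fix e assume e: "e \<in> E'"
    obtain u v where "u \<noteq> v" "e = {u, v}" "u \<in> V" "v \<in> V"
      by (rule simple_graph_edgeE[OF simple subsetD[OF assms(3) e]])
    then show "\<exists>u v. u \<noteq> v \<and> e = {u, v} \<and> u \<in> V' \<and> v \<in> V'" using assms(4)[OF e] by blast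
  qed
  moreover have "inj_on pos V'" using inj_pos assms(2) by (rule inj_on_subset)
  ultimately have "plane_drawing V' E' pos \<gamma>"
  proof (rule plane_drawing.intro)
    show "arc (\<gamma> e)" "{pathstart (\<gamma> e), pathfinish (\<gamma> e)} = pos ` e" if "e \<in> E'" for e
      using edge_arc[of e] edge_ends[of e] that assms(3) by auto
    show "v \<in> e" if "e \<in> E'" "v \<in> V'" "pos v \<in> path_image (\<gamma> e)" for e v
      using vertex_on_edge[of e v] that assms(2,3) by auto
    show "path_image (\<gamma> e1) \<inter> path_image (\<gamma> e2) \<subseteq> pos ` (e1 \<inter> e2)"
      if "e1 \<in> E'" "e2 \<in> E'" "e1 \<noteq> e2" for e1 e2
      using edges_meet[of e1 e2] that assms(3) by auto
  qed
  then show ?thesis unfolding planar_graph_iff by (intro exI)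
qed

text \<open>The constant is weaker than Euler's \<open>-2g\<close>, so that the bound also holds for trees and
  adds up over blocks.\<close>
lemma planar_card_edges_le:
  assumes "planar_graph V E" "V \<noteq> {}" "\<And>C. is_cycle E C \<Longrightarrow> g \<le> length C" "3 \<le> g"
  shows "(int g - 2) * card E \<le> int g * (int (card V) - 1)"
  using assms(1-3)
proof (induction "card E" arbitrary: V E rule: less_induct)
  case less
  have s: "simple_graph V E" using less.prems by (simp add: planar_graph_def)
  have finV: "finite V" and finE: "finite E"
    using s simple_graph_finite_edges by (auto simp: simple_graph_def)
  have cV: "1 \<le> card V" using less.prems(2) finV by (simp add: Suc_le_eq card_gt_0_iff)
  have sub: "\<Union>E \<subseteq> V" using s by (auto simp: simple_graph_def)
  have IH: "(int g - 2) * card F \<le> int g * (int (card (\<Union>F)) - 1)" if F: "F \<subset> E" "F \<noteq> {}" for F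
  proof (rule less.hyps)
    show "card F < card E" using F finE by (simp add: psubset_card_mono)
    show "planar_graph (\<Union>F) F"
      by (rule planar_graph_subset[OF less.prems(1)]) (use F sub in auto)
    obtain e where e: "e \<in> F" using F by blast
    then have "e \<noteq> {}" using simple_graph_edgeE[OF s, of e] F by auto
    then show "\<Union>F \<noteq> {}" using e by blast
    show "g \<le> length C" if "is_cycle F C" for C using less.prems(3) is_cycle_mono[OF that] F by blast
  qed
  show ?case
  proof (cases "\<exists>F. F \<subset> E \<and> F \<noteq> {} \<and> card (\<Union>F \<inter> \<Union>(E - F)) \<le> 1")
    case True
    then obtain F where F: "F \<subset> E" "F \<noteq> {}" "card (\<Union>F \<inter> \<Union>(E - F)) \<le> 1" by blast
    have fin: "finite (\<Union>F)" "finite (\<Union>(E - F))" using F(1) sub finV by (auto intro!: finite_subset[OF _ finV])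
    have "card (\<Union>F \<union> \<Union>(E - F)) \<le> card V" by (rule card_mono[OF finV]) (use F sub in auto)
    then have "card (\<Union>F) + card (\<Union>(E - F)) \<le> card V + 1"
      using F(3) card_Un_Int[OF fin] by linarith
    then have "(int (card (\<Union>F)) - 1) + (int (card (\<Union>(E - F))) - 1) \<le> int (card V) - 1" by linarith
    then have "int g * ((int (card (\<Union>F)) - 1) + (int (card (\<Union>(E - F))) - 1)) \<le> int g * (int (card V) - 1)"
      by (rule mult_left_mono) simp
    moreover have "(int g - 2) * card F \<le> int g * (int (card (\<Union>F)) - 1)" by (rule IH) (use F in auto)
    moreover have "(int g - 2) * card (E - F) \<le> int g * (int (card (\<Union>(E - F))) - 1)" by (rule IH) (use F in auto)
    moreover have "card E = card F + card (E - F)"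
      using F(1) finE by (metis card_Un_disjoint Diff_disjoint Diff_partition finite_Diff finite_subset psubset_imp_subset)
    ultimately show ?thesis by (simp add: algebra_simps)
  next
    case False
    then have two: "2 \<le> card (\<Union>F \<inter> \<Union>(E - F))" if "F \<subseteq> E" "F \<noteq> {}" "F \<noteq> E" for F
      using that by (metis One_nat_def Suc_1 not_less_eq_eq psubsetI)
    show ?thesis
    proof (cases "\<exists>C. is_cycle E C")
      case True
      then obtain C where C: "is_cycle E C" by blast
      have "planar_graph (\<Union>E) E" by (rule planar_graph_subset[OF less.prems(1) sub]) auto
      then obtain pos \<gamma> where "plane_drawing (\<Union>E) E pos \<gamma>" unfolding planar_graph_iff by (elim exE)
      then have "(int g - 2) * card E \<le> int g * card (\<Union>E) - 2 * g"
        by (rule plane_drawing.card_edges_le_two_connected) (use two less.prems(3) assms(4) C in auto)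
      moreover have "int g * card (\<Union>E) \<le> int g * card V"
        using card_mono[OF finV sub] by (intro mult_left_mono) auto
      ultimately have "(int g - 2) * card E \<le> int g * card V - 2 * g" by linarith
      then show ?thesis by (simp add: right_diff_distrib)
    next
      case False
      then have "card E < card V" using forest_card_edges[OF s less.prems(2)] by blast
      then have "(int g - 2) * card E \<le> (int g - 2) * (int (card V) - 1)"
        using assms(4) by (intro mult_left_mono) auto
      also have "\<dots> \<le> int g * (int (card V) - 1)"
        using cV by (intro mult_right_mono) auto
      finally show ?thesis .
    qed
  qed
qed

text \<open>The bound \<open>3n - 3\<close> allows 12 edges on five vertices and does not exclude
  the 10 edges of a complete graph. The bound \<open>3n - 6 = 9\<close> does, at the price of
  checking that this graph is 2-connected.\<close>

lemma planar_clique_card_le_4: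
  assumes "planar_graph V E" "K \<subseteq> V" and adj: "\<And>u v. u \<in> K \<Longrightarrow> v \<in> K \<Longrightarrow> u \<noteq> v \<Longrightarrow> {u, v} \<in> E"
  shows "card K \<le> 4"
proof (rule ccontr)
  assume "\<not> card K \<le> 4"
  then have "5 \<le> card K" by simp
  then obtain K' where K': "K' \<subseteq> K" "card K' = 5" by (meson obtain_subset_with_card_n)
  then have fin: "finite K'" by (metis card.infinite zero_neq_numeral)
  define F where "F = {e. e \<subseteq> K' \<and> card e = 2}"
  have cF: "card F = 10" using n_subsets[OF fin, of 2] K' by (simp add: F_def choose_two)
  have mem: "{u, v} \<in> F" if "u \<in> K'" "v \<in> K'" "u \<noteq> v" for u v using that by (auto simp: F_def)
  have "F \<subseteq> E"
  proof
    fix e assume "e \<in> F"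
    then obtain u v where "e = {u, v}" "u \<noteq> v" "e \<subseteq> K'" by (auto simp: F_def card_2_iff)
    then show "e \<in> E" using adj K' by blast
  qed
  have pl: "planar_graph K' F"
    by (rule planar_graph_subset[OF assms(1) _ \<open>F \<subseteq> E\<close>]) (use K' assms(2) in \<open>auto simp: F_def\<close>)
  have sK: "simple_graph K' F" using pl by (simp add: planar_graph_def)
  have two_edge: "2 \<le> card (\<Union>G)" if G: "G \<subseteq> F" "G \<noteq> {}" for G
  proof -
    obtain e where e: "e \<in> G" "card e = 2" using G by (auto simp: F_def)
    moreover have "finite (\<Union>G)" by (rule finite_subset[OF _ fin]) (use G in \<open>auto simp: F_def\<close>)
    ultimately show ?thesis using card_mono[of "\<Union>G" e] by (simp add: Union_upper)
  qed
  have UF: "\<Union>F = K'"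
  proof
    show "K' \<subseteq> \<Union>F"
    proof
      fix x assume x: "x \<in> K'"
      have "K' \<noteq> {x}" using K' by auto
      then obtain y where "y \<in> K'" "y \<noteq> x" using x by blast
      then show "x \<in> \<Union>F" using mem[OF x] by blast
    qed
  qed (auto simp: F_def)
  \<comment> \<open>If \<open>F - G\<close> misses a vertex \<open>x\<close>, then all edges at
    \<open>x\<close> belong to \<open>G\<close>, so \<open>G\<close> touches every vertex. Hence one
    of the two classes covers \<open>K'\<close>, and the other has at least two vertices.\<close>
  have two: "2 \<le> card (\<Union>G \<inter> \<Union>(F - G))" if G: "G \<subseteq> F" "G \<noteq> {}" "G \<noteq> F" for G
  proof (cases "\<Union>(F - G) = K'")
    case True
    then have "\<Union>G \<inter> \<Union>(F - G) = \<Union>G" using G UF by auto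
    then show ?thesis using two_edge G by simp
  next
    case False
    then obtain x where x: "x \<in> K'" "x \<notin> \<Union>(F - G)" using UF by blast
    have "K' \<subseteq> \<Union>G"
    proof
      fix y assume y: "y \<in> K'"
      show "y \<in> \<Union>G"
      proof (cases "y = x")
        case True
        then show ?thesis using x UF by blast
      next
        case False
        then have "{x, y} \<in> G" using mem[of x y] x y by blast
        then show ?thesis by blast
      qed
    qed
    then have "\<Union>G \<inter> \<Union>(F - G) = \<Union>(F - G)" using UF by blast
    then show ?thesis using two_edge[of "F - G"] G by auto
  qed
  obtain pos \<gamma> where drawing: "plane_drawing K' F pos \<gamma>" using pl unfolding planar_graph_iff by (elim exE)
  have "\<exists>C. is_cycle F C"
  proof (rule ccontr)
    assume "\<nexists>C. is_cycle F C"
    then have "card F < card K'" using K' by (intro forest_card_edges[OF sK]) auto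
    then show False using cF K' by simp
  qed
  then obtain C where C: "is_cycle F C" by blast
  have "3 \<le> length C" if "is_cycle F C" for C using that by (simp add: is_cycle_def)
  from plane_drawing.card_edges_le_two_connected[OF drawing two this _ C UF[symmetric]]
  show False using cF K' by simp
qed

section \<open>Extending colourings\<close>

lemma handshake:
  assumes "simple_graph V E" shows "(\<Sum>v\<in>V. degree E v) = 2 * card E"
  unfolding degree_def
proof (rule sum_multicount)
  show "finite V" using assms by (simp add: simple_graph_def)
  show "finite E" using assms by (rule simple_graph_finite_edges)
  show "\<forall>e\<in>E. card {v \<in> V. v \<in> e} = 2"
  proof
    fix e assume e: "e \<in> E"
    obtain u v where "u \<noteq> v" "e = {u, v}" "u \<in> V" "v \<in> V" by (rule simple_graph_edgeE[OF assms e])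
    then have "{v \<in> V. v \<in> e} = {u, v}" by blast
    then show "card {v \<in> V. v \<in> e} = 2" using \<open>u \<noteq> v\<close> by simp
  qed
qed

lemma degree_mono: "finite E \<Longrightarrow> F \<subseteq> E \<Longrightarrow> degree F v \<le> degree E v"
  unfolding degree_def by (rule card_mono) auto

lemma two_cycle_edges_at_vertex:
  assumes "is_cycle E xs" "v \<in> set xs" shows "2 \<le> card {e \<in> cycle_edges xs. v \<in> e}"
proof -
  obtain as bs where xs: "xs = as @ v # bs" using assms(2) by (meson split_list)
  define zs where "zs = bs @ as"
  have eq: "cycle_edges xs = cycle_edges (v # zs)"
    unfolding xs zs_def using cycle_edges_append_commute[of as "v # bs"] by simp
  have d: "distinct (v # zs)" and len: "2 \<le> length zs"
    using assms(1) by (auto simp: is_cycle_def xs zs_def)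
  obtain y z ys where zs: "zs = y # z # ys"
    using len by (auto simp: numeral_2_eq_2 Suc_le_length_iff)
  have ne: "last zs \<noteq> y" using d last_in_set[of "z # ys"] by (auto simp: zs)
  have "{{last zs, v}, {v, y}} \<subseteq> {e \<in> cycle_edges xs. v \<in> e}"
    using cycle_edges_Cons[of zs v] by (auto simp: eq zs)
  then have "card {{last zs, v}, {v, y}} \<le> card {e \<in> cycle_edges xs. v \<in> e}"
    by (intro card_mono) auto
  moreover have "card {{last zs, v}, {v, y}} = 2" using ne d by (auto simp: doubleton_eq_iff zs)
  ultimately show ?thesis by simp
qed

section \<open>Colouring an even cycle from lists of two colours\<close>

lemma path_edges_nth: "path_edges xs = {{xs ! i, xs ! Suc i} |i. Suc i < length xs}"
proof (induction xs rule: path_edges.induct)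
  case (1 x y zs)
  have "{{(x # y # zs) ! i, (x # y # zs) ! Suc i} |i. Suc i < length (x # y # zs)}
      = insert {x, y} {{(y # zs) ! i, (y # zs) ! Suc i} |i. Suc i < length (y # zs)}" (is "?L = ?R")
  proof
    show "?L \<subseteq> ?R"
    proof
      fix e assume "e \<in> ?L"
      then obtain i where "Suc i < length (x # y # zs)" "e = {(x # y # zs) ! i, (x # y # zs) ! Suc i}" by blast
      then show "e \<in> ?R" by (cases i) auto
    qed
    have "{x, y} \<in> ?L" by (rule CollectI, rule exI[of _ 0]) simp
    moreover have "{(y # zs) ! i, (y # zs) ! Suc i} \<in> ?L" if "Suc i < length (y # zs)" for i
      by (rule CollectI, rule exI[of _ "Suc i"]) (use that in simp)
    ultimately show "?R \<subseteq> ?L" by blast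
  qed
  then show ?case using 1 by simp
qed auto

lemma cycle_edges_nth:
  assumes "xs \<noteq> []"
  shows "cycle_edges xs = (\<lambda>i. {xs ! i, xs ! (Suc i mod length xs)}) ` {..<length xs}"
proof -
  have "{(xs @ [hd xs]) ! i, (xs @ [hd xs]) ! Suc i} = {xs ! i, xs ! (Suc i mod length xs)}"
    if "i < length xs" for i
    using that assms by (cases "Suc i = length xs") (auto simp: nth_append hd_conv_nth)
  then show ?thesis unfolding cycle_edges_def path_edges_nth by (auto simp: image_iff)
qed

text \<open>If the lists of two cyclically consecutive positions differ, colour greedily starting with a
  colour that is missing in the list of the last position; otherwise two colours alternate.\<close>
lemma even_cycle_choosable:
  fixes L :: "nat \<Rightarrow> 'c set"
  assumes n: "even n" "0 < n" and L: "\<And>i. i < n \<Longrightarrow> 2 \<le> card (L i)"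
  shows "\<exists>c. \<forall>i<n. c i \<in> L i \<and> c i \<noteq> c (Suc i mod n)"
proof (cases "\<exists>s<n. \<not> L (Suc s mod n) \<subseteq> L s")
  case False
  then have "\<And>s. s < n \<Longrightarrow> L (Suc s mod n) \<subseteq> L s" by blast
  from this[OF Suc_lessD] have mono: "L (Suc i) \<subseteq> L i" if "Suc i < n" for i
    using that mod_less[OF that] by metis
  have "L (i + j) \<subseteq> L i" if "i + j < n" for i j
    using that
  proof (induction j)
    case (Suc j)
    then have "L (Suc (i + j)) \<subseteq> L (i + j)" by (intro mono) simp
    then show ?case using Suc by auto
  qed simp
  \<comment> \<open>Along the chain of inclusions the last list is contained in every list, so two
    of its colours can be used throughout.\<close>
  then have L0: "L (n - 1) \<subseteq> L i" if "i < n" for i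
    using that by (metis One_nat_def Suc_pred add_diff_inverse_nat diff_less less_Suc_eq_le n(2) not_less zero_less_Suc)
  have "2 \<le> card (L (n - 1))" using L[of "n - 1"] n(2) by simp
  then obtain T where T: "T \<subseteq> L (n - 1)" "card T = 2" by (meson obtain_subset_with_card_n)
  then obtain x y where xy: "x \<in> L (n - 1)" "y \<in> L (n - 1)" "x \<noteq> y" by (auto simp: card_2_iff)
  show ?thesis
  proof (rule exI[of _ "\<lambda>i. if even i then x else y"], intro allI impI)
    fix i assume i: "i < n"
    have "even (Suc i mod n) \<longleftrightarrow> odd i"
      using i n by (cases "Suc i = n") auto
    then show "(if even i then x else y) \<in> L i \<and>
        (if even i then x else y) \<noteq> (if even (Suc i mod n) then x else y)"
      using xy L0[OF i] by auto
  qed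
next
  case True
  then obtain s x where s: "s < n" and x: "x \<in> L (Suc s mod n)" "x \<notin> L s" by blast
  define t where "t = Suc s mod n"
  have t: "t < n" "t = Suc s \<and> Suc s < n \<or> t = 0 \<and> Suc s = n"
    using s n(2) by (cases "Suc s = n"; simp add: t_def)+
  \<comment> \<open>The greedy choice along \<open>t\<close>, \<open>t + 1\<close>, and so on modulo
    \<open>n\<close>. It runs on for ever, but only the first \<open>n\<close> values are
    used.\<close>
  define d where "d = rec_nat x (\<lambda>j p. SOME y. y \<in> L ((t + Suc j) mod n) \<and> y \<noteq> p)"
  have d: "d (Suc j) \<in> L ((t + Suc j) mod n) \<and> d (Suc j) \<noteq> d j" for j
  proof -
    have "2 \<le> card (L ((t + Suc j) mod n))" using n(2) by (intro L) simp
    then obtain T where "T \<subseteq> L ((t + Suc j) mod n)" "card T = 2" by (meson obtain_subset_with_card_n)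
    then obtain a b where "a \<in> L ((t + Suc j) mod n)" "b \<in> L ((t + Suc j) mod n)" "a \<noteq> b"
      by (auto simp: card_2_iff)
    then have "\<exists>y. y \<in> L ((t + Suc j) mod n) \<and> y \<noteq> d j" by metis
    from someI_ex[OF this] show ?thesis by (simp add: d_def)
  qed
  have d0: "d 0 = x" by (simp add: d_def)
  have dL: "d j \<in> L ((t + j) mod n)" for j
    using d[of "j - 1"] x(1) t(1) d0 by (cases j) (auto simp: t_def)
  \<comment> \<open>\<open>p i\<close> is the number of steps from \<open>t\<close> forward to
    \<open>i\<close>. It drops back to 0 only from \<open>s\<close> to \<open>t\<close>, and there
    the colours differ because \<open>x\<close> is not in the list at \<open>s\<close>.\<close>
  define p where "p = (\<lambda>i. if t \<le> i then i - t else i + n - t)"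
  have step: "p (Suc i mod n) = (if i = s then 0 else Suc (p i))" if "i < n" for i
    using that t s by (cases "Suc i = n") (auto simp: p_def)
  have pL: "(t + p i) mod n = i" if "i < n" for i using that t by (auto simp: p_def)
  show ?thesis
  proof (rule exI[of _ "\<lambda>i. d (p i)"], intro allI impI conjI)
    fix i assume i: "i < n"
    show diL: "d (p i) \<in> L i" using dL[of "p i"] pL[OF i] by simp
    show "d (p i) \<noteq> d (p (Suc i mod n))"
    proof (cases "i = s")
      case True
      then show ?thesis using step[OF i] diL x(2) d0 by auto
    next
      case False
      then show ?thesis using step[OF i] d[of "p i"] by auto
    qed
  qed
qed

lemma free_colour:
  assumes "finite A" "card A < k" obtains c where "c \<in> {1..k}" "c \<notin> A"
proof -
  have "\<not> {1..k} \<subseteq> A" using card_mono[OF assms(1), of "{1..k}"] assms(2) by auto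
  then show ?thesis using that by blast
qed

section \<open>Partial colourings that respect the precolouring\<close>

text \<open>Here \<open>k\<close> plays the part of the maximum degree plus one. The distance
  condition enters in the form of two facts about short walks between vertices of \<open>VH\<close>:
  \<open>H_induced\<close> for one edge and \<open>H_common\<close> for two edges.\<close>

locale precoloured =
  fixes V :: "'a set" and E VH EH and vcH :: "'a \<Rightarrow> nat" and ecH :: "'a set \<Rightarrow> nat" and k :: nat
  assumes planar: "planar_graph V E" and k: "28 \<le> k" and deg: "v \<in> V \<Longrightarrow> degree E v < k"
    and VH: "VH \<subseteq> V" and EH: "EH \<subseteq> E" and EH_VH: "e \<in> EH \<Longrightarrow> e \<subseteq> VH"
    and H_induced: "u \<in> VH \<Longrightarrow> v \<in> VH \<Longrightarrow> {u, v} \<in> E \<Longrightarrow> {u, v} \<in> EH"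
    and H_common: "v \<in> VH \<Longrightarrow> w \<in> VH \<Longrightarrow> v \<noteq> w \<Longrightarrow> {u, v} \<in> E \<Longrightarrow> {u, w} \<in> E \<Longrightarrow> {v, w} \<in> EH"
    and H_coloured: "total_coloring VH EH k vcH ecH"
begin

text \<open>A total colouring of the edge set \<open>F\<close> that ignores the colours of the vertices in \<open>R\<close>. The
  last clause makes the vertex colours respect all edges of \<open>E\<close> at \<open>VH\<close>, also those outside \<open>F\<close>: a
  vertex of high degree next to \<open>VH\<close> could not be recoloured when such an edge is put back.\<close>
definition colouring :: "'a set set \<Rightarrow> 'a set \<Rightarrow> ('a \<Rightarrow> nat) \<Rightarrow> ('a set \<Rightarrow> nat) \<Rightarrow> bool" where
  "colouring F R vc ec \<longleftrightarrow>
     (\<forall>v\<in>V. vc v \<in> {1..k}) \<and> (\<forall>e\<in>F. ec e \<in> {1..k}) \<and>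
     (\<forall>u v. {u, v} \<in> F \<longrightarrow> u \<notin> R \<longrightarrow> v \<notin> R \<longrightarrow> vc u \<noteq> vc v) \<and>
     (\<forall>e1\<in>F. \<forall>e2\<in>F. e1 \<noteq> e2 \<longrightarrow> e1 \<inter> e2 \<noteq> {} \<longrightarrow> ec e1 \<noteq> ec e2) \<and>
     (\<forall>e\<in>F. \<forall>v\<in>e. v \<notin> R \<longrightarrow> ec e \<noteq> vc v) \<and>
     (\<forall>v\<in>VH. vc v = vcH v) \<and> (\<forall>e\<in>EH. ec e = ecH e) \<and>
     (\<forall>u v. {u, v} \<in> E \<longrightarrow> u \<notin> VH \<longrightarrow> u \<notin> R \<longrightarrow> v \<in> VH \<longrightarrow> vc u \<noteq> vc v)"

definition colourable :: "'a set set \<Rightarrow> bool" where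
  "colourable F \<longleftrightarrow> (\<exists>vc ec. colouring F {} vc ec)"

lemma colouringD:
  assumes "colouring F R vc ec"
  shows "\<And>v. v \<in> V \<Longrightarrow> vc v \<in> {1..k}" "\<And>e. e \<in> F \<Longrightarrow> ec e \<in> {1..k}"
    "\<And>u v. {u, v} \<in> F \<Longrightarrow> u \<notin> R \<Longrightarrow> v \<notin> R \<Longrightarrow> vc u \<noteq> vc v"
    "\<And>e1 e2. e1 \<in> F \<Longrightarrow> e2 \<in> F \<Longrightarrow> e1 \<noteq> e2 \<Longrightarrow> e1 \<inter> e2 \<noteq> {} \<Longrightarrow> ec e1 \<noteq> ec e2"
    "\<And>e v. e \<in> F \<Longrightarrow> v \<in> e \<Longrightarrow> v \<notin> R \<Longrightarrow> ec e \<noteq> vc v"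
    "\<And>v. v \<in> VH \<Longrightarrow> vc v = vcH v" "\<And>e. e \<in> EH \<Longrightarrow> ec e = ecH e"
    "\<And>u v. {u, v} \<in> E \<Longrightarrow> u \<notin> VH \<Longrightarrow> u \<notin> R \<Longrightarrow> v \<in> VH \<Longrightarrow> vc u \<noteq> vc v"
  using assms unfolding colouring_def by auto

lemma simple: "simple_graph V E"
  using planar by (simp add: planar_graph_def)

lemma finite_E: "finite E"
  by (rule simple_graph_finite_edges[OF simple])

lemma adjacent_H_clique:
  assumes "v \<in> neighbours E u \<inter> VH" "w \<in> neighbours E u \<inter> VH" "v \<noteq> w"
  shows "{v, w} \<in> E"
  using H_common[of v w u] EH assms by (auto simp: neighbours_def insert_commute)

lemma card_neighbours_H: "card (neighbours E u \<inter> VH) \<le> 4"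
  by (rule planar_clique_card_le_4[OF planar]) (use VH adjacent_H_clique in blast)+

text \<open>Together with \<open>u\<close> its neighbours in \<open>VH\<close> form a clique, so one
  of the four places is taken by \<open>u\<close>.\<close>

lemma card_neighbours_H': assumes "u \<in> VH" shows "card (neighbours E u \<inter> VH) \<le> 3"
proof -
  have "card (insert u (neighbours E u \<inter> VH)) \<le> 4"
  proof (rule planar_clique_card_le_4[OF planar])
    show "{v, w} \<in> E" if "v \<in> insert u (neighbours E u \<inter> VH)" "w \<in> insert u (neighbours E u \<inter> VH)" "v \<noteq> w" for v w
      using that adjacent_H_clique[of v u w] by (auto simp: neighbours_def insert_commute)
  qed (use VH assms in auto)
  moreover have "u \<notin> neighbours E u" using simple_graph_no_loop[OF simple, of u u] by (auto simp: neighbours_def)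
  moreover have "finite (neighbours E u)" by (rule finite_neighbours[OF simple])
  ultimately show ?thesis by simp
qed

text \<open>Greedy choice, made for all of \<open>R\<close> at once because \<open>R\<close> is
  independent. A vertex \<open>a\<close> avoids the colours of its edges and of its neighbours in
  \<open>F\<close>, which gives \<open>2 * degree F a\<close>, and those of its at most four
  neighbours in \<open>VH\<close> along any edge of \<open>E\<close>.\<close>

lemma recolour:
  assumes col: "colouring F R vc ec" and FE: "F \<subseteq> E" and R: "R \<subseteq> V - VH"
    and indep: "\<And>a b. a \<in> R \<Longrightarrow> b \<in> R \<Longrightarrow> {a, b} \<notin> F"
    and low: "\<And>a. a \<in> R \<Longrightarrow> 2 * degree F a + 4 < k"
  shows "colourable F"
proof -
  have sF: "simple_graph V F" by (rule simple_graph_subset[OF simple FE])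
  note D = colouringD[OF col]
  define forb where "forb a = ec ` {e \<in> F. a \<in> e} \<union> vc ` neighbours F a \<union> vc ` (neighbours E a \<inter> VH)" for a
  have "\<exists>c. c \<in> {1..k} \<and> c \<notin> forb a" if a: "a \<in> R" for a
  proof -
    have fin: "finite {e \<in> F. a \<in> e}" "finite (neighbours F a)" "finite (neighbours E a \<inter> VH)"
      using finite_neighbours[OF sF] finite_neighbours[OF simple] simple_graph_finite_edges[OF sF] by auto
    have "card (forb a) \<le> card (ec ` {e \<in> F. a \<in> e}) + card (vc ` neighbours F a) + card (vc ` (neighbours E a \<inter> VH))"
      unfolding forb_def by (rule order_trans[OF card_Un_le]) (simp add: card_Un_le)
    also have "\<dots> \<le> degree F a + degree F a + 4"
      using card_image_le[OF fin(1), of ec] card_image_le[OF fin(2), of vc] card_image_le[OF fin(3), of vc]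
        card_neighbours[OF sF, of a] card_neighbours_H[of a] unfolding degree_def by linarith
    also have "\<dots> < k" using low[OF a] by simp
    finally have lt: "card (forb a) < k" .
    have "finite (forb a)" using fin by (auto simp: forb_def)
    then show ?thesis using free_colour[OF _ lt] by blast
  qed
  then obtain c where c: "\<And>a. a \<in> R \<Longrightarrow> c a \<in> {1..k}" "\<And>a. a \<in> R \<Longrightarrow> c a \<notin> forb a" by metis
  define vc' where "vc' v = (if v \<in> R then c v else vc v)" for v
  have c_nb: "c a \<noteq> vc b" if "a \<in> R" "{a, b} \<in> F" for a b
    using c(2)[OF that(1)] that(2) by (auto simp: forb_def neighbours_def insert_commute)
  have c_H: "c a \<noteq> vc b" if "a \<in> R" "{a, b} \<in> E" "b \<in> VH" for a b
    using c(2)[OF that(1)] that(2,3) by (auto simp: forb_def neighbours_def insert_commute)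
  have c_e: "c a \<noteq> ec e" if "a \<in> R" "e \<in> F" "a \<in> e" for a e
    using c(2)[OF that(1)] that(2,3) by (auto simp: forb_def)
  have "colouring F {} vc' ec"
    unfolding colouring_def
  proof (intro conjI ballI allI impI)
    show "vc' v \<in> {1..k}" if "v \<in> V" for v using D(1)[OF that] c(1)[of v] by (auto simp: vc'_def)
    show "ec e \<in> {1..k}" if "e \<in> F" for e by (rule D(2)[OF that])
    show "vc' u \<noteq> vc' v" if e: "{u, v} \<in> F" for u v
    proof -
      have e': "{v, u} \<in> F" using e by (simp add: insert_commute)
      consider "u \<in> R" "v \<notin> R" | "u \<notin> R" "v \<in> R" | "u \<notin> R" "v \<notin> R" using indep[of u v] e by blast
      then show ?thesis
      proof cases
        case 1 then show ?thesis using c_nb[OF 1(1) e] by (simp add: vc'_def)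
      next
        case 2 then show ?thesis using c_nb[OF 2(2) e'] by (simp add: vc'_def)
      next
        case 3 then show ?thesis using D(3)[OF e 3] by (simp add: vc'_def)
      qed
    qed
    show "ec e1 \<noteq> ec e2" if "e1 \<in> F" "e2 \<in> F" "e1 \<noteq> e2" "e1 \<inter> e2 \<noteq> {}" for e1 e2
      by (rule D(4)[OF that])
    show "ec e \<noteq> vc' v" if "e \<in> F" "v \<in> e" for e v
      using D(5)[OF that] c_e[OF _ that] unfolding vc'_def by auto
    show "vc' v = vcH v" if "v \<in> VH" for v using D(6)[OF that] R that by (auto simp: vc'_def)
    show "ec e = ecH e" if "e \<in> EH" for e by (rule D(7)[OF that])
    show "vc' u \<noteq> vc' v" if "{u, v} \<in> E" "u \<notin> VH" "v \<in> VH" for u v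
    proof -
      have "v \<notin> R" using R that by auto
      then show ?thesis using D(8)[OF that(1,2) _ that(3)] c_H[OF _ that(1,3)] unfolding vc'_def by auto
    qed
  qed
  then show ?thesis unfolding colourable_def by blast
qed

text \<open>The bookkeeping common to putting back an edge and a cycle: colour the edges
  \<open>Q\<close> while the vertices in \<open>R\<close> count as uncoloured, to be repaired by
  \<open>recolour\<close>.\<close>

lemma colouring_extend:
  assumes col: "colouring (F - Q) {} vc ec" and FE: "F \<subseteq> E" and Q: "Q \<subseteq> F" "Q \<inter> EH = {}"
    and range: "\<And>e. e \<in> Q \<Longrightarrow> ec' e \<in> {1..k}"
    and QQ: "\<And>e f. e \<in> Q \<Longrightarrow> f \<in> Q \<Longrightarrow> e \<noteq> f \<Longrightarrow> e \<inter> f \<noteq> {} \<Longrightarrow> ec' e \<noteq> ec' f"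
    and QF: "\<And>e f. e \<in> Q \<Longrightarrow> f \<in> F - Q \<Longrightarrow> e \<inter> f \<noteq> {} \<Longrightarrow> ec' e \<noteq> ec f"
    and Qv: "\<And>e v. e \<in> Q \<Longrightarrow> v \<in> e \<Longrightarrow> v \<notin> R \<Longrightarrow> ec' e \<noteq> vc v"
    and Qe: "\<And>u v. {u, v} \<in> Q \<Longrightarrow> u \<notin> R \<Longrightarrow> v \<notin> R \<Longrightarrow> vc u \<noteq> vc v"
  shows "colouring F R vc (\<lambda>e. if e \<in> Q then ec' e else ec e)" (is "colouring F R vc ?ec")
proof -
  note D = colouringD[OF col]
  show ?thesis
    unfolding colouring_def
  proof (intro conjI ballI allI impI)
    show "vc v \<in> {1..k}" if "v \<in> V" for v by (rule D(1)[OF that])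
    show "?ec e \<in> {1..k}" if "e \<in> F" for e using D(2)[of e] range[of e] that by auto
    show "vc u \<noteq> vc v" if "{u, v} \<in> F" "u \<notin> R" "v \<notin> R" for u v
      using D(3)[of u v] Qe[of u v] that by (cases "{u, v} \<in> Q") auto
    show "?ec e \<noteq> ?ec f" if "e \<in> F" "f \<in> F" "e \<noteq> f" "e \<inter> f \<noteq> {}" for e f
    proof -
      have "f \<inter> e \<noteq> {}" using that(4) by blast
      then show ?thesis
        using that D(4)[of e f] QQ[of e f] QF[of e f] QF[of f e] by (cases "e \<in> Q"; cases "f \<in> Q") auto
    qed
    show "?ec e \<noteq> vc v" if "e \<in> F" "v \<in> e" "v \<notin> R" for e v
      using D(5)[of e v] Qv[of e v] that by auto
    show "vc v = vcH v" if "v \<in> VH" for v by (rule D(6)[OF that])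
    show "?ec e = ecH e" if "e \<in> EH" for e using D(7)[OF that] Q(2) that by auto
    show "vc u \<noteq> vc v" if "{u, v} \<in> E" "u \<notin> VH" "u \<notin> R" "v \<in> VH" for u v
      using D(8)[of u v] that by auto
  qed
qed

text \<open>The new edge must avoid \<open>degree F u - 1\<close> and \<open>degree F v - 1\<close>
  colours of edges, the colour of \<open>v\<close>, and that of \<open>u\<close> unless it is
  erased. If \<open>u\<close> is not erased, the ends must already differ in colour: exactly one of
  them lies in \<open>VH\<close>, and the last clause of \<open>colouring\<close> kept them apart
  while the edge was missing.\<close>

lemma colourable_add_edge:
  assumes "colourable (F - {{u, v}})" and FE: "F \<subseteq> E" and uv: "{u, v} \<in> F" "{u, v} \<notin> EH"
    and R: "R \<subseteq> {u}" "R \<subseteq> V - VH"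
    and sum: "degree F u + degree F v + (if u \<in> R then 0 else 1) \<le> k"
    and low: "u \<in> R \<Longrightarrow> 2 * degree F u + 4 < k"
    and adj: "u \<notin> R \<Longrightarrow> u \<in> VH \<or> v \<in> VH"
  shows "colourable F"
proof -
  obtain vc ec where col: "colouring (F - {{u, v}}) {} vc ec" using assms(1) by (auto simp: colourable_def)
  have finF: "finite F" using FE finite_E finite_subset by blast
  have ne: "u \<noteq> v" using simple_graph_no_loop[OF simple, of u v] uv FE by auto
  define A where "A w = ec ` ({f \<in> F. w \<in> f} - {{u, v}})" for w
  have cA: "card (A w) + 1 \<le> degree F w" "finite (A w)" if "w = u \<or> w = v" for w
  proof -
    have mem: "{u, v} \<in> {f \<in> F. w \<in> f}" using that uv by auto
    have fin: "finite {f \<in> F. w \<in> f}" using finF by simp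
    have "card (A w) \<le> card ({f \<in> F. w \<in> f} - {{u, v}})"
      unfolding A_def by (rule card_image_le) (use fin in simp)
    also have "\<dots> + 1 = degree F w"
      unfolding degree_def using card_Suc_Diff1[OF fin mem] by simp
    finally show "card (A w) + 1 \<le> degree F w" by simp
    show "finite (A w)" using fin by (simp add: A_def)
  qed
  define B where "B = insert (vc v) (vc ` ({u} - R))"
  have cB: "card B \<le> 1 + (if u \<in> R then 0 else 1)" 
  proof -
    have "{u} - R = (if u \<in> R then {} else {u})" by auto
    then show ?thesis by (auto simp: B_def card_insert_if)
  qed
  have "card (A u \<union> A v \<union> B) \<le> card (A u) + card (A v) + card B"
    by (rule order_trans[OF card_Un_le]) (simp add: card_Un_le)
  also have "\<dots> < k" using cA(1)[of u] cA(1)[of v] cB sum by auto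
  finally have lt: "card (A u \<union> A v \<union> B) < k" .
  obtain c where c: "c \<in> {1..k}" "c \<notin> A u \<union> A v \<union> B"
    by (rule free_colour[OF _ lt]) (use cA(2) in \<open>auto simp: B_def\<close>)
  have "colouring F R vc (\<lambda>e. if e \<in> {{u, v}} then c else ec e)"
  proof (rule colouring_extend[OF col FE])
    show "c \<noteq> ec f" if "e \<in> {{u, v}}" "f \<in> F - {{u, v}}" "e \<inter> f \<noteq> {}" for e f
      using c(2) that by (auto simp: A_def)
    show "c \<noteq> vc w" if "e \<in> {{u, v}}" "w \<in> e" "w \<notin> R" for e w
      using c(2) that by (auto simp: B_def)
    show "vc a \<noteq> vc b" if "{a, b} \<in> {{u, v}}" "a \<notin> R" "b \<notin> R" for a b
    proof -
      have ab: "a = u \<and> b = v \<or> a = v \<and> b = u" using that by (auto simp: doubleton_eq_iff)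
      then have uR: "u \<notin> R" using that by auto
      have uvE: "{u, v} \<in> E" "{v, u} \<in> E" using uv FE by (auto simp: insert_commute)
      have "\<not> (u \<in> VH \<and> v \<in> VH)" using H_induced[of u v] uvE uv by blast
      then have "vc u \<noteq> vc v"
        using adj[OF uR] colouringD(8)[OF col uvE(1)] colouringD(8)[OF col uvE(2)] by fastforce
      then show ?thesis using ab by auto
    qed
  qed (use uv c(1) in auto)
  then show ?thesis
  proof (rule recolour)
    show "{a, b} \<notin> F" if "a \<in> R" "b \<in> R" for a b
      using that R(1) simple_graph_no_loop[OF simple, of a b] FE by auto
    show "2 * degree F a + 4 < k" if "a \<in> R" for a using low that R(1) by auto
  qed (use FE R in auto)
qed

text \<open>The vertices in \<open>S\<close> alternate on the cycle and have no edges besides those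
  of the cycle. Once their colours are erased, an edge of the cycle is constrained from outside only
  at its end off \<open>S\<close>, and two colours remain for it. Consecutive edges must differ,
  which is list colouring of an even cycle.\<close>

lemma colourable_add_cycle:
  assumes good: "colourable (F - cycle_edges xs)" and FE: "F \<subseteq> E"
    and cyc: "is_cycle F xs"
    and S: "S \<subseteq> V - VH" "\<And>a. a \<in> S \<Longrightarrow> degree F a = 2"
    and indep: "\<And>a b. a \<in> S \<Longrightarrow> b \<in> S \<Longrightarrow> {a, b} \<notin> F"
    and alt: "\<And>u v. {u, v} \<in> cycle_edges xs \<Longrightarrow> u \<in> S \<or> v \<in> S"
  shows "colourable F"
proof -
  define Q where "Q = cycle_edges xs"
  define n where "n = length xs"
  define e where "e i = {xs ! i, xs ! (Suc i mod n)}" for i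
  obtain vc ec where col: "colouring (F - Q) {} vc ec" using good by (auto simp: colourable_def Q_def)
  have finF: "finite F" using FE finite_E finite_subset by blast
  have d: "distinct xs" and n3: "3 \<le> n" and QF: "Q \<subseteq> F" using cyc by (auto simp: is_cycle_def Q_def n_def)
  have Qe: "Q = e ` {..<n}" unfolding Q_def e_def n_def by (rule cycle_edges_nth) (use n3 n_def in auto)
  have "card Q = n" unfolding Q_def n_def by (rule card_cycle_edges[OF d]) (use n3 n_def in simp)
  then have inj: "inj_on e {..<n}" by (intro eq_card_imp_inj_on) (simp_all add: Qe)
  have UQ: "\<Union>Q = set xs" unfolding Q_def by (rule Union_cycle_edges) (use n3 n_def in simp)
  have EHS: "f \<inter> S = {}" if "f \<in> EH" for f using EH_VH[OF that] S(1) by blast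
  have touch: "xs ! i \<in> S \<longleftrightarrow> xs ! (Suc i mod n) \<notin> S" if "i < n" for i
    using alt[of "xs ! i" "xs ! (Suc i mod n)"] indep[of "xs ! i" "xs ! (Suc i mod n)"] Qe that QF
    unfolding Q_def[symmetric] e_def by blast
  \<comment> \<open>Membership in \<open>S\<close> changes at each step, also across the closing
    edge from \<open>n - 1\<close> to \<open>0\<close>; hence \<open>n\<close> is even.\<close>
  have par: "xs ! i \<in> S \<longleftrightarrow> (even i \<longleftrightarrow> xs ! 0 \<in> S)" if "i < n" for i
    using that
  proof (induction i)
    case (Suc i) then show ?case using touch[of i] by auto
  qed simp
  have ev: "even n" using touch[of "n - 1"] par[of "n - 1"] n3 by auto
  \<comment> \<open>The end of the edge \<open>e i\<close> that is not in \<open>S\<close>.\<close>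
  define b where "b i = (if xs ! i \<in> S then xs ! (Suc i mod n) else xs ! i)" for i
  have b: "b i \<in> e i" "b i \<notin> S" "\<And>w. w \<in> e i \<Longrightarrow> w \<noteq> b i \<Longrightarrow> w \<in> S" if "i < n" for i
    using touch[OF that] by (auto simp: b_def e_def)
  have two: "2 \<le> card {f \<in> Q. w \<in> f}" if "w \<in> \<Union>Q" for w
    using two_cycle_edges_at_vertex[OF cyc, of w] that unfolding UQ by (simp add: Q_def)
  have card_F: "card {f \<in> F. w \<in> f} = card {f \<in> Q. w \<in> f} + card {f \<in> F - Q. w \<in> f}" for w
  proof -
    have "{f \<in> F. w \<in> f} = {f \<in> Q. w \<in> f} \<union> {f \<in> F - Q. w \<in> f}" using QF by blast
    moreover have "{f \<in> Q. w \<in> f} \<inter> {f \<in> F - Q. w \<in> f} = {}" by blast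
    moreover have "finite {f \<in> Q. w \<in> f}" "finite {f \<in> F - Q. w \<in> f}"
      using finF finite_subset[OF QF finF] by simp_all
    ultimately show ?thesis by (simp only: card_Un_disjoint)
  qed
  have S_full: "f \<in> Q" if "f \<in> F" "a \<in> f" "a \<in> S" "a \<in> \<Union>Q" for f a
  proof -
    have "card {f \<in> F - Q. a \<in> f} = 0" using card_F[of a] two[OF that(4)] S(2)[OF that(3)] by (simp add: degree_def)
    then have "{f \<in> F - Q. a \<in> f} = {}" using finF by simp
    then show ?thesis using that by blast
  qed
  define L where "L i = {1..k} - (ec ` {f \<in> F - Q. b i \<in> f} \<union> {vc (b i)})" for i
  have cL: "2 \<le> card (L i)" if i: "i < n" for i
  proof -
    have bQ: "b i \<in> \<Union>Q" using b(1)[OF i] Qe i by blast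
    have bV: "b i \<in> V" using bQ QF FE simple by (auto simp: simple_graph_def)
    have fin: "finite {f \<in> F - Q. b i \<in> f}" using finF by simp
    have "degree F (b i) < k" using deg[OF bV] degree_mono[OF finite_E FE, of "b i"] by simp
    \<comment> \<open>Of the at most \<open>k - 1\<close> edges at \<open>b i\<close> at least two
      are on the cycle. So at most \<open>k - 3\<close> colours of edges and one vertex colour are
      excluded, which leaves two.\<close>
    then have "card {f \<in> F - Q. b i \<in> f} + 3 \<le> k" using card_F[of "b i"] two[OF bQ] by (simp add: degree_def)
    moreover have "card (ec ` {f \<in> F - Q. b i \<in> f} \<union> {vc (b i)}) \<le> card {f \<in> F - Q. b i \<in> f} + 1"
      using card_Un_le[of "ec ` {f \<in> F - Q. b i \<in> f}" "{vc (b i)}"] card_image_le[OF fin, of ec] by simp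
    moreover have "card {1..k} - card (ec ` {f \<in> F - Q. b i \<in> f} \<union> {vc (b i)}) \<le> card (L i)"
      unfolding L_def by (rule diff_card_le_card_Diff) (use fin in simp)
    ultimately show ?thesis by simp
  qed
  obtain c where c: "\<And>i. i < n \<Longrightarrow> c i \<in> L i" "\<And>i. i < n \<Longrightarrow> c i \<noteq> c (Suc i mod n)"
  proof -
    have "\<exists>c. \<forall>i<n. c i \<in> L i \<and> c i \<noteq> c (Suc i mod n)"
      by (rule even_cycle_choosable[OF ev _ cL]) (use n3 in auto)
    then show ?thesis using that by blast
  qed
  define ec' where "ec' f = c (inv_into {..<n} e f)" for f
  have ec': "ec' (e i) = c i" if "i < n" for i
    using inv_into_f_f[OF inj, of i] that by (simp add: ec'_def)
  have "colouring F (S \<inter> \<Union>Q) vc (\<lambda>f. if f \<in> Q then ec' f else ec f)"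
  proof (rule colouring_extend[OF col FE QF])
    show "Q \<inter> EH = {}"
    proof -
      have "f \<notin> EH" if "f \<in> Q" for f
      proof -
        obtain i where i: "i < n" "f = e i" using \<open>f \<in> Q\<close> Qe by auto
        have "xs ! i \<in> f" "xs ! (Suc i mod n) \<in> f" using i by (auto simp: e_def)
        then show ?thesis using touch[OF i(1)] EHS[of f] by blast
      qed
      then show ?thesis by blast
    qed
    show "ec' f \<in> {1..k}" if "f \<in> Q" for f
      using that c(1) ec' unfolding Qe by (auto simp: L_def)
    show "ec' f \<noteq> ec' g" if fg: "f \<in> Q" "g \<in> Q" "f \<noteq> g" "f \<inter> g \<noteq> {}" for f g
    proof -
      obtain i j where ij: "i < n" "j < n" "f = e i" "g = e j" using fg Qe by auto
      have lt: "Suc i mod n < n" "Suc j mod n < n" using n3 by simp_all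
      have "i \<noteq> j" using ij fg(3) by auto
      have "i = j \<or> i = Suc j mod n \<or> Suc i mod n = j \<or> Suc i mod n = Suc j mod n"
        using fg(4) ij(1,2) lt nth_eq_iff_index_eq[OF d] unfolding ij e_def n_def by auto
      moreover have "i = j" if "Suc i mod n = Suc j mod n"
        using that ij by (metis Suc_inject Suc_lessI Zero_not_Suc mod_less mod_self)
      ultimately have "i = Suc j mod n \<or> j = Suc i mod n" using \<open>i \<noteq> j\<close> by auto
      then show ?thesis using c(2)[OF ij(1)] c(2)[OF ij(2)] ec' ij by auto
    qed
    show "ec' f \<noteq> ec g" if fg: "f \<in> Q" "g \<in> F - Q" "f \<inter> g \<noteq> {}" for f g
    proof -
      obtain i where i: "i < n" "f = e i" using fg(1) Qe by auto
      obtain w where w: "w \<in> f" "w \<in> g" using fg(3) by blast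
      have "w = b i"
      proof (rule ccontr)
        assume "w \<noteq> b i"
        then have "w \<in> S" using b(3)[OF i(1)] w i by simp
        then show False using S_full[of g w] w fg by blast
      qed
      then show ?thesis using c(1)[OF i(1)] ec'[OF i(1)] i w fg by (auto simp: L_def)
    qed
    show "ec' f \<noteq> vc w" if fw: "f \<in> Q" "w \<in> f" "w \<notin> S \<inter> \<Union>Q" for f w
    proof -
      obtain i where i: "i < n" "f = e i" using fw(1) Qe by auto
      have "w \<notin> S" using fw by blast
      then have "w = b i" using b(3)[OF i(1)] fw(2) i by auto
      then show ?thesis using c(1)[OF i(1)] ec'[OF i(1)] i by (auto simp: L_def)
    qed
    show "vc u \<noteq> vc v" if "{u, v} \<in> Q" "u \<notin> S \<inter> \<Union>Q" "v \<notin> S \<inter> \<Union>Q" for u v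
      using that alt[of u v] by (auto simp: Q_def)
  qed
  then show ?thesis
    by (rule recolour) (use FE S indep k in auto)
qed

text \<open>The start of the minimality argument: a vertex outside \<open>VH\<close> has no edge in
  \<open>EH\<close> and only has to avoid the colours of at most four neighbours in
  \<open>VH\<close>.\<close>

lemma colourable_EH: "colourable EH"
proof -
  have H: "\<And>v. v \<in> VH \<Longrightarrow> vcH v \<in> {1..k}" "\<And>e. e \<in> EH \<Longrightarrow> ecH e \<in> {1..k}"
      "\<And>u v. {u, v} \<in> EH \<Longrightarrow> vcH u \<noteq> vcH v"
      "\<And>e f. e \<in> EH \<Longrightarrow> f \<in> EH \<Longrightarrow> e \<noteq> f \<Longrightarrow> e \<inter> f \<noteq> {} \<Longrightarrow> ecH e \<noteq> ecH f"
      "\<And>e v. e \<in> EH \<Longrightarrow> v \<in> e \<Longrightarrow> ecH e \<noteq> vcH v"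
    using H_coloured unfolding total_coloring_def by auto
  have "\<exists>c. c \<in> {1..k} \<and> c \<notin> vcH ` (neighbours E v \<inter> VH)" for v
  proof -
    have fin: "finite (neighbours E v \<inter> VH)" using finite_neighbours[OF simple] by simp
    have lt: "card (vcH ` (neighbours E v \<inter> VH)) < k"
      using card_image_le[OF fin, of vcH] card_neighbours_H[of v] k by linarith
    show ?thesis using free_colour[OF _ lt] fin by blast
  qed
  then obtain c where c: "\<And>v. c v \<in> {1..k}" "\<And>v. c v \<notin> vcH ` (neighbours E v \<inter> VH)" by metis
  define vc where "vc v = (if v \<in> VH then vcH v else c v)" for v
  have "colouring EH {} vc ecH"
    unfolding colouring_def
  proof (intro conjI ballI allI impI)
    show "vc v \<in> {1..k}" for v using H(1)[of v] c(1)[of v] by (simp add: vc_def)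
    show "ecH e \<in> {1..k}" if "e \<in> EH" for e by (rule H(2)[OF that])
    show "vc u \<noteq> vc v" if "{u, v} \<in> EH" for u v using H(3)[OF that] EH_VH[OF that] by (simp add: vc_def)
    show "ecH e1 \<noteq> ecH e2" if "e1 \<in> EH" "e2 \<in> EH" "e1 \<noteq> e2" "e1 \<inter> e2 \<noteq> {}" for e1 e2
      by (rule H(4)[OF that])
    show "ecH e \<noteq> vc v" if "e \<in> EH" "v \<in> e" for e v
    proof -
      have "v \<in> VH" using EH_VH[OF that(1)] that(2) by blast
      then show ?thesis using H(5)[OF that] by (simp add: vc_def)
    qed
    show "vc v = vcH v" if "v \<in> VH" for v using that by (simp add: vc_def)
    show "ecH e = ecH e" for e ..
    show "vc u \<noteq> vc v" if "{u, v} \<in> E" "u \<notin> VH" "v \<in> VH" for u v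
      using c(2)[of u] that by (auto simp: vc_def neighbours_def insert_commute)
  qed
  then show ?thesis unfolding colourable_def by blast
qed

end

section \<open>Minimal non-colourable edge sets\<close>

locale critical = precoloured +
  fixes F
  assumes EH_F: "EH \<subseteq> F" and F_E: "F \<subseteq> E" and not_colourable: "\<not> colourable F"
    and minimal: "EH \<subseteq> F' \<Longrightarrow> F' \<subset> F \<Longrightarrow> colourable F'"
begin

abbreviation d where "d \<equiv> degree F"
abbreviation N where "N \<equiv> neighbours F"

lemma simple_F: "simple_graph V F"
  by (rule simple_graph_subset[OF simple F_E])

lemma finite_V: "finite V"
  using simple by (simp add: simple_graph_def)

lemma finite_F: "finite F"
  by (rule simple_graph_finite_edges[OF simple_F])

lemma finite_N: "finite (N v)"
  by (rule finite_neighbours[OF simple_F])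

lemma card_N: "card (N v) = d v"
  by (rule card_neighbours[OF simple_F])

lemma N_sym: "u \<in> N v \<longleftrightarrow> v \<in> N u"
  by (simp add: neighbours_def insert_commute)

lemma N_V: "N v \<subseteq> V"
  by (rule neighbours_subset[OF simple_F])

lemma N_E: "N v \<subseteq> neighbours E v"
  using F_E by (auto simp: neighbours_def)

lemma d_less: "v \<in> V \<Longrightarrow> d v < k"
  using deg[of v] degree_mono[OF finite_E F_E, of v] by simp

lemma edge_EH_iff:
  assumes "{u, v} \<in> F" shows "{u, v} \<in> EH \<longleftrightarrow> u \<in> VH \<and> v \<in> VH"
  using EH_VH[of "{u, v}"] H_induced[of u v] assms F_E by auto

text \<open>The colour of \<open>u\<close> is erased, so the edge sees only one coloured end;
  \<open>2 * 11 + 4 < 28\<close> permits choosing the colour of \<open>u\<close> last.\<close>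

lemma degree_sum_low:
  assumes "{u, v} \<in> F" "u \<notin> VH" "d u \<le> 11"
  shows "k < d u + d v"
proof (rule ccontr)
  assume "\<not> k < d u + d v"
  then have sum: "d u + d v \<le> k" by simp
  have nEH: "{u, v} \<notin> EH" using edge_EH_iff[OF assms(1)] assms(2) by simp
  have uV: "u \<in> V" using simple_graph_no_loop[OF simple_F assms(1)] by simp
  have "colourable (F - {{u, v}})" using EH_F nEH assms(1) by (intro minimal) auto
  then have "colourable F"
    by (rule colourable_add_edge[OF _ F_E assms(1) nEH, of "{u}"])
      (use sum k assms(2,3) uV in auto)
  then show False using not_colourable by simp
qed

text \<open>No end is erased here: \<open>u\<close> is precoloured and \<open>v\<close> may have
  large degree. One more colour is excluded for the edge, so the bound is weaker by one than in
  \<open>degree_sum_low\<close>.\<close>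

lemma degree_sum_H:
  assumes "{u, v} \<in> F" "u \<in> VH" "v \<notin> VH"
  shows "k \<le> d u + d v"
proof (rule ccontr)
  assume "\<not> k \<le> d u + d v"
  then have sum: "d u + d v + 1 \<le> k" by simp
  have nEH: "{u, v} \<notin> EH" using edge_EH_iff[OF assms(1)] assms(3) by simp
  have "colourable (F - {{u, v}})" using EH_F nEH assms(1) by (intro minimal) auto
  then have "colourable F"
    by (rule colourable_add_edge[OF _ F_E assms(1) nEH, of "{}"])
      (use sum assms(2) in auto)
  then show False using not_colourable by simp
qed

text \<open>A light vertex outside \<open>VH\<close> can be recoloured last, since \<open>2 * 11 + 4 < 28\<close>; the threshold
  for \<open>VH\<close> makes the other end of an edge from a light vertex of \<open>VH\<close> to its complement heavy.\<close>
definition heavy :: "'a set" where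
  "heavy = {v \<in> V. (if v \<in> VH then 14 else 12) \<le> d v}"

definition heavy_degree :: "'a \<Rightarrow> nat" where
  "heavy_degree v = card (N v \<inter> heavy)"

lemma light_neighbour_heavy:
  assumes "{u, v} \<in> F" "u \<notin> heavy" "\<not> (u \<in> VH \<and> v \<in> VH)"
  shows "v \<in> heavy"
proof -
  have V: "u \<in> V" "v \<in> V" using simple_graph_no_loop[OF simple_F assms(1)] by auto
  show ?thesis
  proof (cases "u \<in> VH")
    case True
    then have "k \<le> d u + d v" using degree_sum_H[OF assms(1)] assms(3) by simp
    moreover have "d u \<le> 13" using assms(2) True V by (simp add: heavy_def)
    ultimately show ?thesis using k V by (simp add: heavy_def)
  next
    case False
    then have "d u \<le> 11" using assms(2) V by (simp add: heavy_def)
    moreover have "k < d u + d v" using degree_sum_low[OF assms(1) False] calculation by simp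
    ultimately show ?thesis using k V by (simp add: heavy_def)
  qed
qed

lemma heavy_degree_light:
  assumes "a \<in> V - heavy" "a \<notin> VH" shows "heavy_degree a = d a"
proof -
  have "N a \<subseteq> heavy"
  proof
    fix v assume "v \<in> N a"
    then have "{a, v} \<in> F" by (simp add: neighbours_def insert_commute)
    then show "v \<in> heavy" using light_neighbour_heavy[of a v] assms by simp
  qed
  then have "N a \<inter> heavy = N a" by blast
  then show ?thesis by (simp add: heavy_degree_def card_N)
qed

lemma heavy_degree_light_H:
  assumes "a \<in> V - heavy" "a \<in> VH" shows "d a \<le> heavy_degree a + 3"
proof -
  have "N a \<subseteq> (N a \<inter> heavy) \<union> (neighbours E a \<inter> VH)"
  proof
    fix v assume v: "v \<in> N a"
    then have "{a, v} \<in> F" by (simp add: neighbours_def insert_commute)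
    then show "v \<in> (N a \<inter> heavy) \<union> (neighbours E a \<inter> VH)"
      using light_neighbour_heavy[of a v] assms v N_E by auto
  qed
  moreover have "finite ((N a \<inter> heavy) \<union> (neighbours E a \<inter> VH))"
    using finite_N finite_neighbours[OF simple] by simp
  ultimately have "card (N a) \<le> card ((N a \<inter> heavy) \<union> (neighbours E a \<inter> VH))" by (intro card_mono)
  also have "\<dots> \<le> card (N a \<inter> heavy) + card (neighbours E a \<inter> VH)" by (rule card_Un_le)
  finally show ?thesis using card_neighbours_H'[OF assms(2)] by (simp add: heavy_degree_def card_N)
qed

text \<open>Multipliers of a linear-programming argument: planarity and the absence of even cycles through
  \<open>2\<close>-vertices bound the total weight that heavy vertices receive from their neighbours by less than
  18 per heavy vertex.\<close>
definition weight :: "'a \<Rightarrow> real" where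
  "weight u = (if u \<in> heavy then 5 / 3
     else if 3 \<le> heavy_degree u then 3 - 6 / heavy_degree u
     else if u \<notin> VH \<and> heavy_degree u = 2 then 1 else 0)"

lemma weight_ge:
  assumes "u \<notin> heavy" "m \<le> heavy_degree u" "3 \<le> m" shows "3 - 6 / real m \<le> weight u"
proof -
  have "6 / real (heavy_degree u) \<le> 6 / real m" using assms by (intro divide_left_mono) auto
  then show ?thesis using assms by (simp add: weight_def)
qed

lemma weight_nonneg: "0 \<le> weight u"
proof (cases "u \<notin> heavy \<and> 3 \<le> heavy_degree u")
  case True then show ?thesis using weight_ge[of u 3] by simp
qed (auto simp: weight_def)

text \<open>A light vertex outside \<open>VH\<close> has no \<open>F\<close>-degree 1, because
  \<open>k < d u + d b\<close> and \<open>d b < k\<close>.\<close>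

lemma weight_ge_1:
  assumes "{u, b} \<in> F" "u \<notin> VH" shows "1 \<le> weight u"
proof (cases "u \<in> heavy")
  case False
  have V: "u \<in> V" "b \<in> V" using simple_graph_no_loop[OF simple_F assms(1)] by auto
  have "d u \<le> 11" using False assms(2) V by (simp add: heavy_def)
  then have "k < d u + d b" using degree_sum_low[OF assms] by simp
  then have "2 \<le> d u" using d_less[OF V(2)] by simp
  then have "2 \<le> heavy_degree u" using heavy_degree_light[of u] False assms(2) V by simp
  then show ?thesis using weight_ge[of u 3] False assms(2)
    by (cases "heavy_degree u = 2") (auto simp: weight_def)
qed (simp add: weight_def)

text \<open>A neighbour \<open>b\<close> of moderate degree forces a light \<open>u\<close> to have
  degree at least \<open>29 - 22 = 7\<close>, and \<open>3 - 6 / 7 > 5 / 3\<close>.\<close>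

lemma weight_ge_53:
  assumes "{u, b} \<in> F" "u \<notin> VH" "d b \<le> 22" shows "5 / 3 \<le> weight u"
proof (cases "u \<in> heavy")
  case False
  have V: "u \<in> V" "b \<in> V" using simple_graph_no_loop[OF simple_F assms(1)] by auto
  have "d u \<le> 11" using False assms(2) V by (simp add: heavy_def)
  then have "k < d u + d b" using degree_sum_low[OF assms(1,2)] by simp
  then have "7 \<le> d u" using assms(3) k by simp
  then have "7 \<le> heavy_degree u" using heavy_degree_light[of u] False assms(2) V by simp
  then show ?thesis using weight_ge[of u 7] False by simp
qed (simp add: weight_def)

text \<open>Up to three edges of \<open>u\<close> may stay inside its own clique and miss
  \<open>heavy\<close>. This leaves \<open>28 - 22 - 3 = 3\<close> heavy neighbours for weight 1,
  and \<open>28 - 17 - 3 = 8\<close> for weight at least \<open>5 / 3\<close>.\<close>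

lemma weight_H:
  assumes "{u, b} \<in> F" "u \<in> VH" "b \<notin> VH"
  shows "d b \<le> 22 \<Longrightarrow> 1 \<le> weight u" "d b \<le> 17 \<Longrightarrow> 5 / 3 \<le> weight u"
proof -
  have V: "u \<in> V" using simple_graph_no_loop[OF simple_F assms(1)] by auto
  have sum: "k \<le> d u + d b" by (rule degree_sum_H[OF assms])
  show "1 \<le> weight u" if "d b \<le> 22"
  proof (cases "u \<in> heavy")
    case False
    then have "3 \<le> heavy_degree u" using heavy_degree_light_H[of u] sum that k V assms(2) by simp
    then show ?thesis using weight_ge[of u 3] False by simp
  qed (simp add: weight_def)
  show "5 / 3 \<le> weight u" if "d b \<le> 17"
  proof (cases "u \<in> heavy")
    case False
    then have "8 \<le> heavy_degree u" using heavy_degree_light_H[of u] sum that k V assms(2) by simp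
    then show ?thesis using weight_ge[of u 8] False by simp
  qed (simp add: weight_def)
qed

lemma sum_weight_ge:
  assumes "T \<subseteq> N b" "\<And>u. u \<in> T \<Longrightarrow> c \<le> weight u"
  shows "real (card T) * c \<le> (\<Sum>u\<in>N b. weight u)"
proof -
  have "real (card T) * c \<le> sum weight T" by (rule sum_bounded_below[OF assms(2)])
  also have "\<dots> \<le> sum weight (N b)"
    by (rule sum_mono2[OF finite_N assms(1)]) (rule weight_nonneg)
  finally show ?thesis .
qed

text \<open>Only light vertices of \<open>VH\<close> may give less than 1. Degree at least 23 makes
  up for four of them, as \<open>23 - 4 = 19\<close>. A heavy vertex of \<open>VH\<close> of degree
  at most 22 has at least \<open>14 - 3 = 11\<close> neighbours outside \<open>VH\<close>, each
  giving \<open>5 / 3\<close>; this is a reason for the threshold 14. Otherwise a degree of at most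
  22 makes every neighbour give 1, and one of at most 17 makes every neighbour give
  \<open>5 / 3\<close>, so that \<open>18 * 1\<close> and \<open>12 * (5 / 3)\<close>
  suffice.\<close>

lemma charge_ge_18:
  assumes b: "b \<in> heavy" shows "18 \<le> (\<Sum>u\<in>N b. weight u)"
proof -
  have edge: "{u, b} \<in> F" if "u \<in> N b" for u using that by (simp add: neighbours_def)
  have "N b \<inter> VH \<subseteq> neighbours E b \<inter> VH" using N_E by blast
  then have NH: "card (N b \<inter> VH) \<le> card (neighbours E b \<inter> VH)"
    using finite_neighbours[OF simple, of b] by (intro card_mono) auto
  have cN: "card (N b - VH) + card (N b \<inter> VH) = d b"
    using card_N[of b] card_Int_Diff[OF finite_N, of b VH] by simp
  consider "23 \<le> d b" | "b \<in> VH" "d b \<le> 22" | "b \<notin> VH" "18 \<le> d b" "d b \<le> 22" | "b \<notin> VH" "d b \<le> 17"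
    by linarith
  then show ?thesis
  proof cases
    case 1
    have "real (card (N b - VH)) * 1 \<le> (\<Sum>u\<in>N b. weight u)"
      by (rule sum_weight_ge) (use weight_ge_1 edge in auto)
    then show ?thesis using 1 cN NH card_neighbours_H[of b] by linarith
  next
    case 2
    have "real (card (N b - VH)) * (5 / 3) \<le> (\<Sum>u\<in>N b. weight u)"
      by (rule sum_weight_ge) (use weight_ge_53 edge 2 in auto)
    moreover have "14 \<le> d b" using b 2 by (simp add: heavy_def)
    then have "11 \<le> card (N b - VH)" using cN NH card_neighbours_H'[OF 2(1)] by linarith
    then have "11 \<le> real (card (N b - VH))" by simp
    ultimately show ?thesis by linarith
  next
    case 3
    have "1 \<le> weight u" if "u \<in> N b" for u
      using weight_ge_1[OF edge[OF that]] weight_H(1)[OF edge[OF that]] 3 by (cases "u \<in> VH") auto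
    then have "real (card (N b)) * 1 \<le> (\<Sum>u\<in>N b. weight u)" by (intro sum_weight_ge) auto
    then show ?thesis using 3 by (simp add: card_N)
  next
    case 4
    have "5 / 3 \<le> weight u" if "u \<in> N b" for u
      using weight_ge_53[OF edge[OF that]] weight_H(2)[OF edge[OF that]] 4 by (cases "u \<in> VH") auto
    then have "real (card (N b)) * (5 / 3) \<le> (\<Sum>u\<in>N b. weight u)" by (intro sum_weight_ge) auto
    moreover have "12 \<le> d b" using b 4 by (simp add: heavy_def)
    ultimately show ?thesis by (simp add: card_N)
  qed
qed

section \<open>Edge counts and the total weight\<close>

definition cross :: "'a set \<Rightarrow> 'a set set" where
  "cross S = {e \<in> F. \<exists>a\<in>S. \<exists>b\<in>heavy. e = {a, b}}"

lemma heavy_V: "heavy \<subseteq> V"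
  by (auto simp: heavy_def)

lemma cross_planar:
  assumes "S \<subseteq> V - heavy" shows "planar_graph (S \<union> heavy) (cross S)"
  by (rule planar_graph_subset[OF planar]) (use assms heavy_V F_E in \<open>auto simp: cross_def\<close>)

lemma card_cross:
  assumes "S \<subseteq> V - heavy" shows "(\<Sum>a\<in>S. heavy_degree a) = card (cross S)"
proof -
  have s: "simple_graph (S \<union> heavy) (cross S)" using cross_planar[OF assms] by (simp add: planar_graph_def)
  have "heavy_degree a = card {e \<in> cross S. a \<in> e}" if a: "a \<in> S" for a
  proof -
    have "neighbours (cross S) a = N a \<inter> heavy"
      unfolding neighbours_def cross_def using a assms by (auto simp: doubleton_eq_iff)
    then show ?thesis using card_neighbours[OF s, of a] by (simp add: heavy_degree_def degree_def)
  qed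
  then have "(\<Sum>a\<in>S. heavy_degree a) = (\<Sum>a\<in>S. card {e \<in> cross S. a \<in> e})" by simp
  also have "\<dots> = 1 * card (cross S)"
  proof (rule sum_multicount)
    show "finite S" using assms finite_V finite_subset by blast
    show "finite (cross S)" using finite_F by (simp add: cross_def)
    show "\<forall>e\<in>cross S. card {a \<in> S. a \<in> e} = 1"
    proof
      fix e assume "e \<in> cross S"
      then obtain a b where "a \<in> S" "b \<in> heavy" "e = {a, b}" by (auto simp: cross_def)
      then have "{a \<in> S. a \<in> e} = {a}" using assms by auto
      then show "card {a \<in> S. a \<in> e} = 1" by simp
    qed
  qed
  finally show ?thesis by simp
qed

lemma heavy_nonempty: "heavy \<noteq> {}"
proof -
  have "F \<noteq> EH" using not_colourable colourable_EH by auto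
  then obtain e where e: "e \<in> F" "e \<notin> EH" using EH_F by blast
  obtain u v where uv: "e = {u, v}" by (rule simple_graph_edgeE[OF simple_F e(1)])
  then have "\<not> (u \<in> VH \<and> v \<in> VH)" using edge_EH_iff[of u v] e by simp
  then show ?thesis using light_neighbour_heavy[of u v] e uv by blast
qed

lemma finite_heavy: "finite heavy"
  using finite_V heavy_V finite_subset by blast

definition A3 :: "'a set" where "A3 = {a \<in> V - heavy. 3 \<le> heavy_degree a}"
text \<open>Vertices of \<open>VH\<close> are left out because the cycle argument erases the colours
  of its \<open>2\<close>-vertices.\<close>

definition A2 :: "'a set" where "A2 = {a \<in> V - heavy - VH. heavy_degree a = 2}"

lemma sum_heavy: "(\<Sum>u\<in>heavy. real (heavy_degree u)) \<le> 6 * real (card heavy) - 6"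
proof -
  define G where "G = {e \<in> F. e \<subseteq> heavy}"
  have pl: "planar_graph heavy G"
    by (rule planar_graph_subset[OF planar heavy_V]) (use F_E in \<open>auto simp: G_def\<close>)
  then have s: "simple_graph heavy G" by (simp add: planar_graph_def)
  have "heavy_degree u = degree G u" if "u \<in> heavy" for u
  proof -
    have "neighbours G u = N u \<inter> heavy" using that by (auto simp: neighbours_def G_def)
    then show ?thesis using card_neighbours[OF s, of u] by (simp add: heavy_degree_def)
  qed
  then have "(\<Sum>u\<in>heavy. heavy_degree u) = 2 * card G" using handshake[OF s] by simp
  moreover have "(int 3 - 2) * card G \<le> int 3 * (int (card heavy) - 1)"
    by (rule planar_card_edges_le[OF pl heavy_nonempty]) (auto simp: is_cycle_def)
  ultimately have "int (\<Sum>u\<in>heavy. heavy_degree u) \<le> 6 * int (card heavy) - 6" by simp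
  then have "real_of_int (int (\<Sum>u\<in>heavy. heavy_degree u)) \<le> real_of_int (6 * int (card heavy) - 6)"
    by (simp only: of_int_le_iff)
  then show ?thesis by simp
qed

text \<open>The graph between \<open>A3\<close> and \<open>heavy\<close> is bipartite and so has no
  triangle; the planar bound with \<open>g = 4\<close> gives at most \<open>2 (n - 1)\<close> edges.
  Each summand is three times the excess of the degree over 2, so that \<open>card A3\<close>
  cancels.\<close>

lemma sum_A3: "(\<Sum>a\<in>A3. 3 * real (heavy_degree a) - 6) \<le> 6 * real (card heavy) - 6"
proof -
  have sub: "A3 \<subseteq> V - heavy" by (auto simp: A3_def)
  have fin: "finite A3" using finite_V by (simp add: A3_def)
  have girth: "4 \<le> length C" if C: "is_cycle (cross A3) C" for C
  proof (rule ccontr)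
    assume "\<not> 4 \<le> length C"
    then have "length C = 3" using C by (simp add: is_cycle_def)
    then obtain x y z where xyz: "C = [x, y, z]" by (auto simp: numeral_3_eq_3 length_Suc_conv)
    have "{x, y} \<in> cross A3" "{y, z} \<in> cross A3" "{z, x} \<in> cross A3"
      using C by (auto simp: xyz is_cycle_def cycle_edges_def)
    moreover have "p \<in> heavy \<longleftrightarrow> q \<notin> heavy" if "{p, q} \<in> cross A3" for p q
      using that sub by (auto simp: cross_def doubleton_eq_iff)
    ultimately show False by blast
  qed
  have "(int 4 - 2) * card (cross A3) \<le> int 4 * (int (card (A3 \<union> heavy)) - 1)"
    by (rule planar_card_edges_le[OF cross_planar[OF sub] _ girth]) (use heavy_nonempty in auto)
  moreover have "card (A3 \<union> heavy) = card A3 + card heavy"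
    using sub fin finite_heavy by (intro card_Un_disjoint) auto
  ultimately have "int (\<Sum>a\<in>A3. heavy_degree a) \<le> 2 * int (card A3) + 2 * int (card heavy) - 2"
    using card_cross[OF sub] by simp
  then have "real_of_int (int (\<Sum>a\<in>A3. heavy_degree a)) \<le> real_of_int (2 * int (card A3) + 2 * int (card heavy) - 2)"
    by (simp only: of_int_le_iff)
  then have "(\<Sum>a\<in>A3. real (heavy_degree a)) \<le> 2 * real (card A3) + 2 * real (card heavy) - 2" by simp
  then show ?thesis by (simp add: sum_subtractf flip: sum_distrib_left)
qed

text \<open>A cycle between \<open>A2\<close> and \<open>heavy\<close> could be deleted by
  minimality and put back by \<open>colourable_add_cycle\<close>. So there is a forest with
  \<open>2 * card A2\<close> edges on \<open>card A2 + card heavy\<close> vertices.\<close>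

lemma card_A2: "card A2 < card heavy"
proof -
  have sub: "A2 \<subseteq> V - heavy" by (auto simp: A2_def)
  have fin: "finite A2" using finite_V by (simp add: A2_def)
  have "\<not> is_cycle (cross A2) C" for C
  proof
    assume C: "is_cycle (cross A2) C"
    then have CF: "is_cycle F C" by (rule is_cycle_mono) (auto simp: cross_def)
    have Ccross: "cycle_edges C \<subseteq> cross A2" using C by (simp add: is_cycle_def)
    have "card (cycle_edges C) \<noteq> 0" using C card_cycle_edges[of C] by (auto simp: is_cycle_def)
    then have ne: "cycle_edges C \<noteq> {}" by auto
    have "e \<notin> EH" if "e \<in> cross A2" for e
      using that EH_VH[of e] by (auto simp: cross_def A2_def)
    then have "EH \<subseteq> F - cycle_edges C" using EH_F Ccross by blast
    moreover have "F - cycle_edges C \<subset> F" using ne Ccross by (auto simp: cross_def)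
    ultimately have "colourable (F - cycle_edges C)" by (rule minimal)
    then have "colourable F"
    proof (rule colourable_add_cycle[OF _ F_E CF, of A2])
      show "A2 \<subseteq> V - VH" by (auto simp: A2_def)
      show "d a = 2" if "a \<in> A2" for a using heavy_degree_light[of a] that by (simp add: A2_def)
      show "{a, b} \<notin> F" if "a \<in> A2" "b \<in> A2" for a b
        using light_neighbour_heavy[of a b] that by (auto simp: A2_def)
      show "u \<in> A2 \<or> v \<in> A2" if "{u, v} \<in> cycle_edges C" for u v
        using that Ccross by (auto simp: cross_def doubleton_eq_iff)
    qed
    then show False using not_colourable by simp
  qed
  then have "card (cross A2) < card (A2 \<union> heavy)"
    using cross_planar[OF sub] heavy_nonempty by (intro forest_card_edges) (auto simp: planar_graph_def)
  moreover have "card (A2 \<union> heavy) = card A2 + card heavy"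
    using sub fin finite_heavy by (intro card_Un_disjoint) auto
  moreover have "card (cross A2) = 2 * card A2" using card_cross[OF sub] by (simp add: A2_def)
  ultimately show ?thesis by simp
qed

lemma contradiction: False
proof -
  let ?h = "real (card heavy)"
  have "18 * ?h \<le> (\<Sum>b\<in>heavy. \<Sum>u\<in>N b. weight u)"
    using sum_bounded_below[of heavy 18 "\<lambda>b. \<Sum>u\<in>N b. weight u"] charge_ge_18 by (simp add: mult.commute)
  also have "\<dots> = (\<Sum>b\<in>heavy. \<Sum>u\<in>V. if u \<in> N b then weight u else 0)"
  proof (rule sum.cong[OF refl])
    fix b
    have "V \<inter> N b = N b" using N_V by blast
    then show "sum weight (N b) = (\<Sum>u\<in>V. if u \<in> N b then weight u else 0)"
      using sum.inter_restrict[OF finite_V, of weight "N b"] by simp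
  qed
  also have "\<dots> = (\<Sum>u\<in>V. \<Sum>b\<in>heavy. if u \<in> N b then weight u else 0)"
    by (rule sum.swap)
  also have "\<dots> = (\<Sum>u\<in>V. weight u * real (heavy_degree u))"
  proof (rule sum.cong[OF refl])
    fix u
    have "heavy \<inter> {b. u \<in> N b} = N u \<inter> heavy" using N_sym by blast
    then show "(\<Sum>b\<in>heavy. if u \<in> N b then weight u else 0) = weight u * real (heavy_degree u)"
      using finite_heavy by (simp add: sum.If_cases heavy_degree_def)
  qed
  \<comment> \<open>The form of \<open>weight\<close> pays off: multiplied by the heavy degree,
    \<open>3 - 6 / heavy_degree u\<close> becomes the summand of \<open>sum_A3\<close>, and a vertex
    of \<open>A2\<close> contributes 2.\<close>
  also have "\<dots> = (\<Sum>u\<in>V. (if u \<in> heavy then 5 / 3 * real (heavy_degree u) else 0)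
      + (if u \<in> A3 then 3 * real (heavy_degree u) - 6 else 0) + (if u \<in> A2 then 2 else 0))"
    by (rule sum.cong[OF refl]) (auto simp: weight_def A3_def A2_def field_simps)
  also have "\<dots> = 5 / 3 * (\<Sum>u\<in>heavy. real (heavy_degree u)) + (\<Sum>u\<in>A3. 3 * real (heavy_degree u) - 6) + 2 * real (card A2)"
  proof -
    have "V \<inter> heavy = heavy" "V \<inter> A3 = A3" "V \<inter> A2 = A2" using heavy_V by (auto simp: A3_def A2_def)
    then show ?thesis using finite_V by (simp add: sum.distrib sum.If_cases sum_distrib_left)
  qed
  \<comment> \<open>The total is less than
    \<open>5 / 3 * (6 * ?h - 6) + (6 * ?h - 6) + 2 * ?h\<close>, that is,
    \<open>18 * ?h - 16\<close>.\<close>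
  also have "\<dots> < 18 * ?h" using sum_heavy sum_A3 card_A2 by linarith
  finally show False by simp
qed

end

lemma (in precoloured) colourable_E: "colourable E"
proof (rule ccontr)
  assume "\<not> colourable E"
  then have "EH \<subseteq> E \<and> E \<subseteq> E \<and> \<not> colourable E" using EH by blast
  from ex_has_least_nat[of "\<lambda>F. EH \<subseteq> F \<and> F \<subseteq> E \<and> \<not> colourable F", OF this, of card]
  obtain F where F: "EH \<subseteq> F" "F \<subseteq> E" "\<not> colourable F"
    and min: "\<And>F'. EH \<subseteq> F' \<Longrightarrow> F' \<subseteq> E \<Longrightarrow> \<not> colourable F' \<Longrightarrow> card F \<le> card F'" by auto
  have "critical V E VH EH vcH ecH k F"
  proof (intro critical.intro critical_axioms.intro)
    show "precoloured V E VH EH vcH ecH k" by (rule precoloured_axioms)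
    show "colourable F'" if "EH \<subseteq> F'" "F' \<subset> F" for F'
    proof (rule ccontr)
      assume "\<not> colourable F'"
      then have "card F \<le> card F'" using min[of F'] that F by blast
      moreover have "finite F" using F(2) finite_E finite_subset by blast
      ultimately show False using psubset_card_mono[of F F'] that by simp
    qed
  qed (use F in auto)
  then show False by (rule critical.contradiction)
qed

theorem theorem1p12:
  fixes V :: "'a set" and E :: "'a set set" and VH :: "'a set" and EH :: "'a set set"
  assumes "planar_graph V E"
    and "max_degree V E \<ge> 27"
    and "distance3_cliques V E VH EH"
    and "total_coloring VH EH (max_degree V E + 1) vcH ecH"
  shows "\<exists>vc ec. total_coloring V E (max_degree V E + 1) vc ec \<and>
           (\<forall>v\<in>VH. vc v = vcH v) \<and> (\<forall>e\<in>EH. ec e = ecH e)"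
proof -
  have simple: "simple_graph V E" using assms(1) by (simp add: planar_graph_def)
  then have finV: "finite V" by (simp add: simple_graph_def)
  have sub: "VH \<subseteq> V" "EH \<subseteq> E" "\<And>e. e \<in> EH \<Longrightarrow> e \<subseteq> VH"
    using assms(3) by (auto simp: distance3_cliques_def subgraph_def)
  \<comment> \<open>\<open>length p\<close> counts vertices, so a walk on at most three vertices has
    at most two edges, too few for distance 3.\<close>
  have short: "{v, w} \<in> EH" if "v \<in> VH" "w \<in> VH" "v \<noteq> w" "walk V E p" "hd p = v" "last p = w" "length p \<le> 3" for v w p
  proof (rule ccontr)
    assume "{v, w} \<notin> EH"
    then have "dist_at_least V E 3 v w" using assms(3) that(1-3) unfolding distance3_cliques_def by blast
    then have "3 \<le> length p - 1" using that(4-6) unfolding dist_at_least_def by blast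
    then show False using that(7) by simp
  qed
  interpret precoloured V E VH EH vcH ecH "max_degree V E + 1"
  proof
    show "degree E v < max_degree V E + 1" if "v \<in> V" for v
    proof -
      have "degree E v \<le> Sup (degree E ` V)" using that finV by (intro cSup_upper) auto
      then show ?thesis by (simp add: max_degree_def)
    qed
    show "{u, v} \<in> EH" if uv: "u \<in> VH" "v \<in> VH" "{u, v} \<in> E" for u v
    proof (rule short[OF uv(1,2), of "[u, v]"])
      show "u \<noteq> v" using simple_graph_no_loop[OF simple uv(3)] by simp
      show "walk V E [u, v]" using uv sub by (auto simp: walk_def less_Suc_eq nth_Cons')
    qed simp_all
    show "{v, w} \<in> EH" if vw: "v \<in> VH" "w \<in> VH" "v \<noteq> w" "{u, v} \<in> E" "{u, w} \<in> E" for u v w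
    proof (rule short[OF vw(1-3), of "[v, u, w]"])
      have "{v, u} \<in> E" "u \<in> V" using vw(4) simple_graph_no_loop[OF simple vw(4)] by (auto simp: insert_commute)
      then show "walk V E [v, u, w]" using vw sub by (auto simp: walk_def less_Suc_eq nth_Cons')
    qed simp_all
  qed (use assms sub in auto)
  obtain vc ec where col: "colouring E {} vc ec" using colourable_E unfolding colourable_def by blast
  note D = colouringD[OF col]
  have "total_coloring V E (max_degree V E + 1) vc ec"
    unfolding total_coloring_def using D(1-5) by simp
  then show ?thesis using D(6,7) by blast
qed

end
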